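(* Let $r,n\ge 1$ be integers and $G=G(r,n)=\mathbb{Z}_r\wr S_n$. For any $g\in G$, $$\sum_{\chi\in\mathrm{Irr}(G)}\chi(g)=\#\{v\in G \mid v\cdot\bar v=g\}.$$
   Context: $\mathbb{Z}_r$ is the additive group of integers modulo $r$. $G(r,n)=\mathbb{Z}_r\wr S_n=\{(\sigma,(z_1,\dots,z_n)) : \sigma\in S_n,\ z_j\in\mathbb{Z}_r\}$, with multiplication $$(\sigma,(c_1,\dots,c_n))\cdot(\tau,(d_1,\dots,d_n))=(\sigma\tau,(c_{\tau(1)}+d_1,\dots,c_{\tau(n)}+d_n)),$$ where $\sigma\tau$ means first apply $\tau$, then $\sigma$. For $v=(\sigma,(z_1,\dots,z_n))\in G(r,n)$, the bar operation is $\bar v:=(\sigma,(-z_1,\dots,-z_n))$. $\mathrm{Irr}(G)$ is the set of irreducible complex characters of $G$. *)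

theory Defs
  imports
    "HOL-Algebra.Sym_Groups"
    "HOL-Algebra.Product_Groups"
    "HOL-Algebra.Elementary_Groups"
    "Jordan_Normal_Form.VS_Connect"
begin

section \<open>The group \<open>G(r,n)\<close>\<close>

text \<open>
  The permutations are those of \<open>{1..n}\<close>, composed as functions, so the right-hand factor acts
  first. The colour vectors are the elements of the \<open>n\<close>-fold direct power of
  \<open>\<int>\<close> modulo \<open>r\<close>, that is, functions that are \<^const>\<open>undefined\<close> outside \<open>{1..n}\<close>, with entries
  in \<open>{0..<r}\<close>. The library sets \<open>integer_mod_group 0\<close> to be the integers; the intended range
  is \<open>r \<ge> 1\<close>.
\<close>

definition wreath_group :: "nat \<Rightarrow> nat \<Rightarrow> ((nat \<Rightarrow> nat) \<times> (nat \<Rightarrow> int)) monoid" where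
  "wreath_group r n =
    \<lparr> carrier = carrier (sym_group n) \<times> carrier (product_group {1..n} (\<lambda>_. integer_mod_group r)),
      monoid.mult = (\<lambda>(\<sigma>, c) (\<tau>, d).
        (\<sigma> \<otimes>\<^bsub>sym_group n\<^esub> \<tau>,
         \<lambda>j\<in>{1..n}. c (\<tau> j) \<otimes>\<^bsub>integer_mod_group r\<^esub> d j)),
      one = (\<one>\<^bsub>sym_group n\<^esub>, \<one>\<^bsub>product_group {1..n} (\<lambda>_. integer_mod_group r)\<^esub>) \<rparr>"

definition bar ::
  "nat \<Rightarrow> nat \<Rightarrow> (nat \<Rightarrow> nat) \<times> (nat \<Rightarrow> int) \<Rightarrow> (nat \<Rightarrow> nat) \<times> (nat \<Rightarrow> int)" where
  "bar r n = (\<lambda>(\<sigma>, z). (\<sigma>, \<lambda>j\<in>{1..n}. inv\<^bsub>integer_mod_group r\<^esub> (z j)))"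

lemma wreath_group_is_group: "group (wreath_group r n)"
proof -
  obtain Z where Z: "integer_mod_group r = Z" and "group Z"
    using group_integer_mod_group by blast
  then interpret Z: group Z by simp
  obtain I where I: "{1..n} = I" by blast
  note wr = wreath_group_def[of r n, unfolded Z I] and sg = sym_group_def[of n, unfolded I]
  have perm: "\<tau> j \<in> I" if "\<tau> permutes I" "j \<in> I" for \<tau> j
    using that permutes_in_image by metis
  show ?thesis
  proof (rule groupI)
    fix x y assume xy: "x \<in> carrier (wreath_group r n)" "y \<in> carrier (wreath_group r n)"
    obtain \<sigma> c \<tau> d where [simp]: "x = (\<sigma>, c)" "y = (\<tau>, d)"
      by (cases x, cases y)
    have p: "\<sigma> permutes I" "\<tau> permutes I"
      and C: "c \<in> I \<rightarrow>\<^sub>E carrier Z" "d \<in> I \<rightarrow>\<^sub>E carrier Z"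
      using xy by (auto simp: wr sg)
    have "c (\<tau> j) \<otimes>\<^bsub>Z\<^esub> d j \<in> carrier Z" if "j \<in> I" for j
      using PiE_mem[OF C(1) perm[OF p(2) that]] PiE_mem[OF C(2) that] by (rule Z.m_closed)
    then show "x \<otimes>\<^bsub>wreath_group r n\<^esub> y \<in> carrier (wreath_group r n)"
      using permutes_compose[OF p(2,1)] by (simp add: wr sg)
  next
    show "\<one>\<^bsub>wreath_group r n\<^esub> \<in> carrier (wreath_group r n)"
      using Z.one_closed
      by (auto simp: wr sg permutes_id product_group_def)
  next
    fix x y z assume xyz: "x \<in> carrier (wreath_group r n)" "y \<in> carrier (wreath_group r n)"
      "z \<in> carrier (wreath_group r n)"
    obtain \<sigma> c \<tau> d \<rho> e where [simp]: "x = (\<sigma>, c)" "y = (\<tau>, d)" "z = (\<rho>, e)"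
      by (cases x, cases y, cases z)
    have p: "\<sigma> permutes I" "\<tau> permutes I" "\<rho> permutes I"
      and C: "\<And>j. j \<in> I \<Longrightarrow> c j \<in> carrier Z"
        "\<And>j. j \<in> I \<Longrightarrow> d j \<in> carrier Z"
        "\<And>j. j \<in> I \<Longrightarrow> e j \<in> carrier Z"
      using xyz by (auto simp: wr sg PiE_iff)
    have "(\<lambda>j\<in>I. (\<lambda>j\<in>I. c (\<tau> j) \<otimes>\<^bsub>Z\<^esub> d j) (\<rho> j)
              \<otimes>\<^bsub>Z\<^esub> e j)
        = (\<lambda>j\<in>I. c ((\<tau> \<circ> \<rho>) j) \<otimes>\<^bsub>Z\<^esub>
              (\<lambda>j\<in>I. d (\<rho> j) \<otimes>\<^bsub>Z\<^esub> e j) j)"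
    proof (rule restrict_ext)
      fix j assume j: "j \<in> I"
      have a: "\<rho> j \<in> I" "\<tau> (\<rho> j) \<in> I"
        using perm[OF p(3) j] perm[OF p(2)] by blast+
      show "(\<lambda>j\<in>I. c (\<tau> j) \<otimes>\<^bsub>Z\<^esub> d j) (\<rho> j)
              \<otimes>\<^bsub>Z\<^esub> e j
          = c ((\<tau> \<circ> \<rho>) j) \<otimes>\<^bsub>Z\<^esub>
              (\<lambda>j\<in>I. d (\<rho> j) \<otimes>\<^bsub>Z\<^esub> e j) j"
        using Z.m_assoc[OF C(1)[OF a(2)] C(2)[OF a(1)] C(3)[OF j]] a j
        by simp
    qed
    then show "x \<otimes>\<^bsub>wreath_group r n\<^esub> y \<otimes>\<^bsub>wreath_group r n\<^esub> z
        = x \<otimes>\<^bsub>wreath_group r n\<^esub> (y \<otimes>\<^bsub>wreath_group r n\<^esub> z)"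
      by (simp add: wr sg comp_assoc)
  next
    fix x assume x: "x \<in> carrier (wreath_group r n)"
    obtain \<sigma> c where [simp]: "x = (\<sigma>, c)" by (cases x)
    have p: "\<sigma> permutes I" and C: "c \<in> I \<rightarrow>\<^sub>E carrier Z"
      using x by (auto simp: wr sg)
    have "(\<lambda>j\<in>I. (\<lambda>j\<in>I. \<one>\<^bsub>Z\<^esub>) (\<sigma> j)
            \<otimes>\<^bsub>Z\<^esub> c j) = c"
    proof
      fix j
      show "(\<lambda>j\<in>I. (\<lambda>j\<in>I. \<one>\<^bsub>Z\<^esub>) (\<sigma> j)
            \<otimes>\<^bsub>Z\<^esub> c j) j = c j"
      proof (cases "j \<in> I")
        case True
        then show ?thesis
          using perm[OF p True] Z.l_one[OF PiE_mem[OF C True]]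
          by simp
      next
        case False
        then show ?thesis
          using PiE_arb[OF C False] by simp
      qed
    qed
    then show "\<one>\<^bsub>wreath_group r n\<^esub> \<otimes>\<^bsub>wreath_group r n\<^esub> x = x"
      by (simp add: wr sg product_group_def)
    define y where "y = (Hilbert_Choice.inv \<sigma>, \<lambda>j\<in>I. inv\<^bsub>Z\<^esub> (c (Hilbert_Choice.inv \<sigma> j)))"
    have q: "Hilbert_Choice.inv \<sigma> permutes I" using p by (rule permutes_inv)
    have "inv\<^bsub>Z\<^esub> (c (Hilbert_Choice.inv \<sigma> j)) \<in> carrier Z" if "j \<in> I" for j
      using PiE_mem[OF C perm[OF q that]] by (rule Z.inv_closed)
    then have "y \<in> carrier (wreath_group r n)"
      using q by (simp add: y_def wr sg)
    moreover have "y \<otimes>\<^bsub>wreath_group r n\<^esub> x = \<one>\<^bsub>wreath_group r n\<^esub>"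
    proof -
      have "(\<lambda>j\<in>I. (\<lambda>j\<in>I. inv\<^bsub>Z\<^esub> (c (Hilbert_Choice.inv \<sigma> j))) (\<sigma> j)
            \<otimes>\<^bsub>Z\<^esub> c j) = (\<lambda>j\<in>I. \<one>\<^bsub>Z\<^esub>)"
      proof (rule restrict_ext)
        fix j assume j: "j \<in> I"
        show "(\<lambda>j\<in>I. inv\<^bsub>Z\<^esub> (c (Hilbert_Choice.inv \<sigma> j))) (\<sigma> j)
            \<otimes>\<^bsub>Z\<^esub> c j = \<one>\<^bsub>Z\<^esub>"
          using perm[OF p j] Z.l_inv[OF PiE_mem[OF C j]] permutes_inverses(2)[OF p]
          by simp
      qed
      then show ?thesis
        using permutes_inv_o(2)[OF p]
        by (simp add: y_def wr sg product_group_def)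
    qed
    ultimately show "\<exists>y\<in>carrier (wreath_group r n).
        y \<otimes>\<^bsub>wreath_group r n\<^esub> x = \<one>\<^bsub>wreath_group r n\<^esub>"
      by blast
  qed
qed


section \<open>Irreducible complex characters\<close>

text \<open>
  Representations are taken in matrix form: homomorphisms into \<open>GL\<^sub>d(\<complex>)\<close>, the group of units
  of the ring of complex \<open>d \<times> d\<close> matrices.
\<close>

definition matrix_rep :: "('a, 'b) monoid_scheme \<Rightarrow> nat \<Rightarrow> ('a \<Rightarrow> complex mat) \<Rightarrow> bool" where
  "matrix_rep G d \<rho> \<longleftrightarrow> \<rho> \<in> hom G (units_of (ring_mat TYPE(complex) d ()))"

definition invariant_subspace ::
  "('a, 'b) monoid_scheme \<Rightarrow> nat \<Rightarrow> ('a \<Rightarrow> complex mat) \<Rightarrow> complex vec set \<Rightarrow> bool" where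
  "invariant_subspace G d \<rho> W \<longleftrightarrow>
    VectorSpace.subspace class_ring W (module_vec TYPE(complex) d) \<and>
    (\<forall>g\<in>carrier G. \<forall>w\<in>W. \<rho> g *\<^sub>v w \<in> W)"

definition irreducible_rep :: "('a, 'b) monoid_scheme \<Rightarrow> nat \<Rightarrow> ('a \<Rightarrow> complex mat) \<Rightarrow> bool" where
  "irreducible_rep G d \<rho> \<longleftrightarrow> matrix_rep G d \<rho> \<and> d > 0 \<and>
    (\<forall>W. invariant_subspace G d \<rho> W \<longrightarrow> W = {0\<^sub>v d} \<or> W = carrier_vec d)"

definition trace :: "'a :: comm_monoid_add mat \<Rightarrow> 'a" where
  "trace A = (\<Sum>i<dim_row A. A $$ (i, i))"

text \<open>
  Characters are restricted to the carrier, so that two of them are equal as HOL functions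
  iff they agree on the group. Hence \<open>Irr G\<close> contains each irreducible character exactly once
  and is finite whenever \<open>G\<close> is a finite group.
\<close>

definition character :: "('a, 'b) monoid_scheme \<Rightarrow> ('a \<Rightarrow> complex mat) \<Rightarrow> 'a \<Rightarrow> complex" where
  "character G \<rho> = (\<lambda>g\<in>carrier G. trace (\<rho> g))"

definition Irr :: "('a, 'b) monoid_scheme \<Rightarrow> ('a \<Rightarrow> complex) set" where
  "Irr G = {character G \<rho> | d \<rho>. irreducible_rep G d \<rho>}"

end

theory Submission
  imports Defs "Jordan_Normal_Form.Spectral_Radius"
begin

text \<open>
  An element \<open>(\<sigma>, z)\<close> of \<open>G(r,n)\<close> is a monomial matrix whose nonzero entries are \<open>r\<close>-th roots of
  unity. The bar operation is complex conjugation of that matrix, so \<open>\<theta> g = (bar g)\<^sup>-\<^sup>1\<close> is its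
  transpose: an anti-automorphism of order at most two, and \<open>v * bar v = v * (\<theta> v)\<^sup>-\<^sup>1\<close>.

  The number of \<open>v\<close> with \<open>v * (\<theta> v)\<^sup>-\<^sup>1 = g\<close> is a class function of \<open>g\<close>, hence a combination of
  irreducible characters, and its coefficient at \<open>\<chi>\<close> is the twisted Frobenius-Schur indicator
  \<open>1/|G| * (\<Sum>v. \<chi> (v * (\<theta> v)\<^sup>-\<^sup>1))\<close>. The theorem says that all these indicators are \<open>1\<close>. Let
  \<open>\<rho>\<close> afford \<open>\<chi>\<close>. Then \<open>\<rho>' g = (\<rho> (\<theta> g))\<^sup>T\<close> is again a representation, and it has the same
  character because \<open>g\<close> and \<open>\<theta> g\<close> are conjugate. If every matrix \<open>A\<close> with \<open>\<rho> g * A = A * \<rho>' g\<close>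
  for all \<open>g\<close> is symmetric, the indicator becomes the ordinary inner product of \<open>\<chi>\<close> with itself
  (\<open>sum_twisted_squares\<close>). As the transpose of an intertwiner is an intertwiner, it suffices that
  no nonzero intertwiner is skew; this is the predicate \<open>no_skew_form\<close>.

  Skew intertwiners are excluded by descent along the chain \<open>1 \<subseteq> K\<^sub>0 \<subseteq> K\<^sub>1 \<subseteq> \<dots> \<subseteq> K\<^sub>n = G(r,n)\<close>,
  where \<open>K\<^sub>m\<close> consists of the elements, of arbitrary colours, whose permutation moves only
  letters from \<open>{1..m}\<close>. The combinatorial input is that each \<open>g\<close> in a member of the chain is
  conjugate to \<open>\<theta> g\<close> by an element of the preceding member (\<open>reversing_permutation\<close>): a permutation
  that reverses every cycle of \<open>\<sigma>\<close> can be chosen to fix a given letter. Now let \<open>\<rho>\<close> be irreducible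
  for one member, let \<open>P\<close> be an equivariant projection onto an irreducible constituent for the
  preceding member, and write \<open>P = (\<Sum>g. a g * \<rho> g)\<close>. The conjugacy gives \<open>a (\<theta> g) = a g\<close>, whence
  \<open>P * A = A * P\<^sup>T\<close> for every intertwiner \<open>A\<close>; therefore a nonzero skew \<open>A\<close> compresses to a
  nonzero skew intertwiner of the constituent (\<open>no_skew_form_transfer\<close>). At the bottom the group is
  trivial, its irreducible representations are one-dimensional, and a skew \<open>1 \<times> 1\<close> matrix is zero.

  The character theory behind these steps (Schur's lemma, Maschke's averaging, the orthogonality
  relations, and the fact that irreducible characters detect class functions) is developed for
  matrix representations of an arbitrary finite group.
\<close>


section \<open>Complex matrices and subspaces\<close>

lemma subspace_vec_iff:
  "VectorSpace.subspace class_ring W (module_vec TYPE(complex) d) \<longleftrightarrow>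
    W \<subseteq> carrier_vec d \<and> 0\<^sub>v d \<in> W \<and> (\<forall>v\<in>W. \<forall>w\<in>W. v + w \<in> W)
      \<and> (\<forall>a. \<forall>v\<in>W. a \<cdot>\<^sub>v v \<in> W)"
  unfolding VectorSpace.subspace_def LinearCombinations.submodule_def
  using vec_vs[of d, where 'a = complex] vectorspace.axioms(1)[OF vec_vs[of d, where 'a = complex]]
  by (auto simp: module_vec_simps)

lemma eq_mat_by_vecI:
  fixes A B :: "'a :: semiring_1 mat"
  assumes A: "A \<in> carrier_mat n m" and B: "B \<in> carrier_mat n m"
    and eq: "\<And>x. x \<in> carrier_vec m \<Longrightarrow> A *\<^sub>v x = B *\<^sub>v x"
  shows "A = B"
proof (rule eq_matI)
  fix i j assume "i < dim_row B" "j < dim_col B"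
  then have ij: "i < n" "j < m" using B by auto
  have "(A *\<^sub>v unit_vec m j) $ i = (B *\<^sub>v unit_vec m j) $ i" using eq[of "unit_vec m j"] by simp
  then show "A $$ (i, j) = B $$ (i, j)" using A B ij by simp
qed (use A B in auto)

lemma index_mult_mat_sum:
  assumes "A \<in> carrier_mat n m" "B \<in> carrier_mat m l" "i < n" "j < l"
  shows "(A * B) $$ (i, j) = (\<Sum>k<m. A $$ (i, k) * B $$ (k, j))"
  using assms by (auto simp: scalar_prod_def atLeast0LessThan intro!: sum.cong)

lemma index_mult_vec_sum:
  assumes "A \<in> carrier_mat n m" "x \<in> carrier_vec m" "i < n"
  shows "(A *\<^sub>v x) $ i = (\<Sum>k<m. A $$ (i, k) * x $ k)"
  using assms by (auto simp: scalar_prod_def atLeast0LessThan intro!: sum.cong)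

lemma trace_mult_comm:
  fixes A B :: "'a :: comm_semiring_0 mat"
  assumes A: "A \<in> carrier_mat n m" and B: "B \<in> carrier_mat m n"
  shows "trace (A * B) = trace (B * A)"
proof -
  have "trace (A * B) = (\<Sum>i<n. \<Sum>k<m. A $$ (i, k) * B $$ (k, i))"
    using A B by (auto simp: trace_def index_mult_mat_sum[OF A B] simp del: index_mult_mat(1) intro!: sum.cong)
  also have "\<dots> = (\<Sum>k<m. \<Sum>i<n. B $$ (k, i) * A $$ (i, k))"
    by (subst sum.swap) (simp add: mult.commute)
  also have "\<dots> = trace (B * A)"
    using A B by (auto simp: trace_def index_mult_mat_sum[OF B A] simp del: index_mult_mat(1) intro!: sum.cong)
  finally show ?thesis .
qed

lemma trace_transpose:
  assumes "A \<in> carrier_mat n n" shows "trace (transpose_mat A) = trace A"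
  using assms by (auto simp: trace_def)

lemma trace_smult:
  fixes A :: "'a :: comm_semiring_0 mat"
  assumes "A \<in> carrier_mat n n" shows "trace (a \<cdot>\<^sub>m A) = a * trace A"
  using assms by (auto simp: trace_def sum_distrib_left intro!: sum.cong)

lemma trace_one: "trace (1\<^sub>m n :: 'a :: semiring_1 mat) = of_nat n"
  by (simp add: trace_def)

text \<open>
  Padding \<open>X\<close> and \<open>Y\<close> by zeros to square matrices keeps the product, so the padded \<open>X\<close> and \<open>Y\<close>
  would be mutually inverse although one of them has a zero row.
\<close>

lemma dim_le_of_one_mat:
  fixes X Y :: "'a :: field mat"
  assumes X: "X \<in> carrier_mat m N" and Y: "Y \<in> carrier_mat N m" and XY: "X * Y = 1\<^sub>m m"
  shows "m \<le> N"
proof (rule ccontr)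
  assume "\<not> m \<le> N"
  then have lt: "N < m" by simp
  define X' where "X' = mat m m (\<lambda>(i, j). if j < N then X $$ (i, j) else 0)"
  define Y' where "Y' = mat m m (\<lambda>(i, j). if i < N then Y $$ (i, j) else 0)"
  have [simp]: "X' \<in> carrier_mat m m" "Y' \<in> carrier_mat m m" by (auto simp: X'_def Y'_def)
  have "X' * Y' = 1\<^sub>m m"
  proof (rule eq_matI)
    fix i j assume "i < dim_row (1\<^sub>m m :: 'a mat)" "j < dim_col (1\<^sub>m m :: 'a mat)"
    then have ij: "i < m" "j < m" by auto
    have "(X' * Y') $$ (i, j) = (\<Sum>k<m. if k < N then X $$ (i, k) * Y $$ (k, j) else 0)"
      using ij by (subst index_mult_mat_sum[of _ m m _ m]) (auto simp: X'_def Y'_def intro!: sum.cong)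
    also have "\<dots> = (\<Sum>k<N. X $$ (i, k) * Y $$ (k, j))"
      using lt by (intro sum.mono_neutral_cong_right) auto
    also have "\<dots> = (X * Y) $$ (i, j)" using index_mult_mat_sum[OF X Y ij] by simp
    finally show "(X' * Y') $$ (i, j) = (1\<^sub>m m :: 'a mat) $$ (i, j)" using XY by simp
  qed (auto simp: X'_def Y'_def)
  then have "Y' * X' = 1\<^sub>m m" by (intro mat_mult_left_right_inverse[of X']) auto
  moreover have "(Y' * X') $$ (N, N) = 0"
    using lt by (subst index_mult_mat_sum[of _ m m _ m]) (auto simp: Y'_def)
  ultimately show False using lt by simp
qed

text \<open>
  A basis of \<open>W\<close> together with dual functionals: the columns of \<open>Q\<close> are the basis and the rows of
  \<open>C\<close> the functionals. Keeping \<open>C\<close> with \<open>Q\<close> makes independence the matrix identity \<open>C * Q = 1\<close>. A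
  frame of maximal size spans \<open>W\<close>, since a vector \<open>w\<close> outside its span enlarges it.
\<close>

lemma subspace_frame:
  assumes W: "VectorSpace.subspace class_ring W (module_vec TYPE(complex) d)"
  obtains k Q C where "Q \<in> carrier_mat d k" "C \<in> carrier_mat k d" "C * Q = 1\<^sub>m k"
    "W = (\<lambda>x. Q *\<^sub>v x) ` carrier_vec k"
proof -
  note W' = W[unfolded subspace_vec_iff]
  have Wc: "\<And>v. v \<in> W \<Longrightarrow> v \<in> carrier_vec d" and W0: "0\<^sub>v d \<in> W"
    and Wadd: "\<And>v w. v \<in> W \<Longrightarrow> w \<in> W \<Longrightarrow> v + w \<in> W" and Wsm: "\<And>a v. v \<in> W \<Longrightarrow> a \<cdot>\<^sub>v v \<in> W"
    using W' by blast+
  define F where "F k \<longleftrightarrow> (\<exists>Q C. Q \<in> carrier_mat d k \<and> C \<in> carrier_mat k d \<and> C * Q = 1\<^sub>m k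
    \<and> (\<forall>x\<in>carrier_vec k. Q *\<^sub>v x \<in> W))" for k
  have "F 0"
    unfolding F_def
  proof (intro exI conjI ballI)
    fix x :: "complex vec" assume "x \<in> carrier_vec 0"
    then have "0\<^sub>m d 0 *\<^sub>v x = 0\<^sub>v d" by (intro eq_vecI) (auto simp: scalar_prod_def)
    then show "0\<^sub>m d 0 *\<^sub>v x \<in> W" using W0 by simp
  qed (auto intro!: eq_matI)
  moreover have "\<forall>k. F k \<longrightarrow> k \<le> d"
    unfolding F_def using dim_le_of_one_mat by blast
  ultimately obtain k where Fk: "F k" and max: "\<And>k'. F k' \<Longrightarrow> k' \<le> k"
    using GreatestI_nat[of F 0 d] Greatest_le_nat[of F _ d] by blast
  then obtain Q C where Q: "Q \<in> carrier_mat d k" and C: "C \<in> carrier_mat k d"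
    and CQ: "C * Q = 1\<^sub>m k" and QW: "\<And>x. x \<in> carrier_vec k \<Longrightarrow> Q *\<^sub>v x \<in> W"
    unfolding F_def by blast
  have "w \<in> (\<lambda>x. Q *\<^sub>v x) ` carrier_vec k" if w: "w \<in> W" for w
  proof (rule ccontr)
    assume not: "\<not> ?thesis"
    have wc: "w \<in> carrier_vec d" using w Wc by blast
    then have Cw: "C *\<^sub>v w \<in> carrier_vec k" using C by simp
    with not have ne: "w \<noteq> Q *\<^sub>v (C *\<^sub>v w)" by blast
    have "\<exists>p<d. w $ p \<noteq> (Q *\<^sub>v (C *\<^sub>v w)) $ p"
      using ne wc Q by (metis carrier_matD(1) carrier_vecD dim_mult_mat_vec eq_vecI)
    then obtain p where p: "p < d" "w $ p - (Q *\<^sub>v (C *\<^sub>v w)) $ p \<noteq> 0" by auto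
    \<comment> \<open>The new basis vector is the part of \<open>w\<close> killed by \<open>C\<close>, scaled to have \<open>p\<close>-th entry \<open>1\<close>; the
      new functional is the \<open>p\<close>-th coordinate, corrected to vanish on the columns of \<open>Q\<close>.\<close>
    define a where "a = inverse (w $ p - (Q *\<^sub>v (C *\<^sub>v w)) $ p)"
    define u where "u = a \<cdot>\<^sub>v (w + (-1) \<cdot>\<^sub>v (Q *\<^sub>v (C *\<^sub>v w)))"
    have uW: "u \<in> W" unfolding u_def by (intro Wsm Wadd w QW Cw)
    then have uc: "u \<in> carrier_vec d" by (rule Wc)
    have up: "u $ p = 1" using p Q C by (simp add: u_def a_def)
    have Cu: "C *\<^sub>v u = 0\<^sub>v k"
    proof -
      have "C *\<^sub>v (Q *\<^sub>v (C *\<^sub>v w)) = C *\<^sub>v w"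
        using C Q Cw CQ by (simp add: assoc_mult_mat_vec[symmetric, of C k d Q k])
      moreover have "C *\<^sub>v u = a \<cdot>\<^sub>v (C *\<^sub>v w + (-1) \<cdot>\<^sub>v (C *\<^sub>v (Q *\<^sub>v (C *\<^sub>v w))))"
        unfolding u_def using C Q wc
        by (simp add: mult_mat_vec[of C k d] mult_add_distrib_mat_vec[of C k d])
      ultimately show ?thesis using C by (intro eq_vecI) auto
    qed
    define Q' where "Q' = mat d (Suc k) (\<lambda>(i, j). if j < k then Q $$ (i, j) else u $ i)"
    define C' where "C' = mat (Suc k) d (\<lambda>(i, j). if i < k then C $$ (i, j)
        else (if j = p then 1 else 0) - (Q * C) $$ (p, j))"
    have Q'c: "Q' \<in> carrier_mat d (Suc k)" and C'c: "C' \<in> carrier_mat (Suc k) d"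
      by (auto simp: Q'_def C'_def)
    have QC: "Q * C \<in> carrier_mat d d" using Q C by auto
    have QCQ: "(Q * C) * Q = Q" using Q C CQ by (simp add: assoc_mult_mat[of Q d k C d Q k])
    have QCu: "(Q * C) *\<^sub>v u = 0\<^sub>v d" using Q C uc Cu
      by (simp add: assoc_mult_mat_vec[of Q d k C d]) (auto intro!: eq_vecI simp: scalar_prod_def)
    have "C' * Q' = 1\<^sub>m (Suc k)"
    proof (rule eq_matI)
      fix i j assume "i < dim_row (1\<^sub>m (Suc k) :: complex mat)" "j < dim_col (1\<^sub>m (Suc k) :: complex mat)"
      then have ij: "i < Suc k" "j < Suc k" by auto
      have "(C' * Q') $$ (i, j) = (\<Sum>q<d. C' $$ (i, q) * Q' $$ (q, j))"
        by (rule index_mult_mat_sum[OF C'c Q'c ij])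
      also have "\<dots> = (1\<^sub>m (Suc k) :: complex mat) $$ (i, j)"
      proof -
        consider "i < k" "j < k" | "i < k" "j = k" | "i = k" "j < k" | "i = k" "j = k"
          using ij by linarith
        then show ?thesis
        proof cases
          case 1
          then have "(\<Sum>q<d. C' $$ (i, q) * Q' $$ (q, j)) = (C * Q) $$ (i, j)"
            by (subst index_mult_mat_sum[OF C Q]) (auto simp: C'_def Q'_def intro!: sum.cong)
          then show ?thesis using 1 CQ by simp
        next
          case 2
          then have "(\<Sum>q<d. C' $$ (i, q) * Q' $$ (q, j)) = (C *\<^sub>v u) $ i"
            by (subst index_mult_vec_sum[OF C uc]) (auto simp: C'_def Q'_def intro!: sum.cong)
          then show ?thesis using 2 Cu by simp
        next
          case 3
          then have "(\<Sum>q<d. C' $$ (i, q) * Q' $$ (q, j))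
              = (\<Sum>q<d. (if q = p then 1 else 0) * Q $$ (q, j) - (Q * C) $$ (p, q) * Q $$ (q, j))"
            by (auto simp: C'_def Q'_def left_diff_distrib intro!: sum.cong)
          also have "\<dots> = (\<Sum>q<d. if q = p then Q $$ (q, j) else 0) - ((Q * C) * Q) $$ (p, j)"
            unfolding index_mult_mat_sum[OF QC Q p(1) 3(2)] sum_subtractf
            by (intro arg_cong2[of _ _ _ _ minus] sum.cong refl) auto
          also have "\<dots> = 0" using p unfolding QCQ by simp
          finally show ?thesis using 3 by simp
        next
          case 4
          then have "(\<Sum>q<d. C' $$ (i, q) * Q' $$ (q, j))
              = (\<Sum>q<d. (if q = p then 1 else 0) * u $ q - (Q * C) $$ (p, q) * u $ q)"
            by (auto simp: C'_def Q'_def left_diff_distrib intro!: sum.cong)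
          also have "\<dots> = (\<Sum>q<d. if q = p then u $ q else 0) - ((Q * C) *\<^sub>v u) $ p"
            unfolding index_mult_vec_sum[OF QC uc p(1)] sum_subtractf
            by (intro arg_cong2[of _ _ _ _ minus] sum.cong refl) auto
          also have "\<dots> = 1" using p up unfolding QCu by simp
          finally show ?thesis using 4 by simp
        qed
      qed
      finally show "(C' * Q') $$ (i, j) = (1\<^sub>m (Suc k) :: complex mat) $$ (i, j)" .
    qed (use Q'c C'c in auto)
    moreover have "Q' *\<^sub>v x \<in> W" if x: "x \<in> carrier_vec (Suc k)" for x
    proof -
      have "Q' *\<^sub>v x = Q *\<^sub>v vec k (\<lambda>i. x $ i) + x $ k \<cdot>\<^sub>v u"
      proof (rule eq_vecI)
        fix i assume "i < dim_vec (Q *\<^sub>v vec k (\<lambda>i. x $ i) + x $ k \<cdot>\<^sub>v u)"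
        then have i: "i < d" using uc by simp
        show "(Q' *\<^sub>v x) $ i = (Q *\<^sub>v vec k (\<lambda>i. x $ i) + x $ k \<cdot>\<^sub>v u) $ i"
          using i uc Q by (simp add: index_mult_vec_sum[OF Q'c x i] index_mult_vec_sum[OF Q _ i]
              del: index_mult_mat_vec) (simp add: Q'_def mult.commute)
      qed (use Q'c uc in auto)
      then show ?thesis using QW uW Wadd Wsm by simp
    qed
    ultimately have "F (Suc k)" unfolding F_def using Q'c C'c by blast
    then show False using max by fastforce
  qed
  then have "W = (\<lambda>x. Q *\<^sub>v x) ` carrier_vec k" using QW by blast
  then show ?thesis using that Q C CQ by blast
qed

text \<open>
  Matrices of all sizes share one type, which is therefore no additive monoid; hence sums are formed
  entrywise, with the size given explicitly.
\<close>

definition mat_sum :: "nat \<Rightarrow> nat \<Rightarrow> ('a \<Rightarrow> 'b :: comm_monoid_add mat) \<Rightarrow> 'a set \<Rightarrow> 'b mat" where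
  "mat_sum n m F S = mat n m (\<lambda>(i, j). \<Sum>x\<in>S. F x $$ (i, j))"

lemma mat_sum_carrier [simp]: "mat_sum n m F S \<in> carrier_mat n m"
  by (simp add: mat_sum_def)

lemma index_mat_sum [simp]:
  "i < n \<Longrightarrow> j < m \<Longrightarrow> mat_sum n m F S $$ (i, j) = (\<Sum>x\<in>S. F x $$ (i, j))"
  "dim_row (mat_sum n m F S) = n" "dim_col (mat_sum n m F S) = m"
  by (simp_all add: mat_sum_def)

lemma mat_sum_cong:
  "S = T \<Longrightarrow> (\<And>x. x \<in> T \<Longrightarrow> F x = G x) \<Longrightarrow> mat_sum n m F S = mat_sum n m G T"
  by (auto simp: mat_sum_def)

lemma mat_sum_reindex:
  "bij_betw h S T \<Longrightarrow> mat_sum n m F T = mat_sum n m (\<lambda>x. F (h x)) S"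
  by (intro eq_matI) (simp_all add: sum.reindex_bij_betw[of h S T, symmetric])

lemma mult_mat_sum:
  fixes A :: "'b :: comm_semiring_0 mat"
  assumes A: "A \<in> carrier_mat l n" and F: "\<And>x. x \<in> S \<Longrightarrow> F x \<in> carrier_mat n m"
  shows "A * mat_sum n m F S = mat_sum l m (\<lambda>x. A * F x) S"
proof (rule eq_matI)
  fix i j assume "i < dim_row (mat_sum l m (\<lambda>x. A * F x) S)" "j < dim_col (mat_sum l m (\<lambda>x. A * F x) S)"
  then have ij: "i < l" "j < m" by auto
  have "(A * mat_sum n m F S) $$ (i, j) = (\<Sum>k<n. \<Sum>x\<in>S. A $$ (i, k) * F x $$ (k, j))"
    using ij by (simp add: index_mult_mat_sum[OF A mat_sum_carrier ij] sum_distrib_left)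
  also have "\<dots> = (\<Sum>x\<in>S. (A * F x) $$ (i, j))"
    by (subst sum.swap) (intro sum.cong refl index_mult_mat_sum[OF A F ij, symmetric])
  finally show "(A * mat_sum n m F S) $$ (i, j) = mat_sum l m (\<lambda>x. A * F x) S $$ (i, j)"
    using ij by simp
qed (use A in auto)

lemma transpose_mat_sum:
  assumes F: "\<And>x. x \<in> S \<Longrightarrow> F x \<in> carrier_mat n m"
  shows "transpose_mat (mat_sum n m F S) = mat_sum m n (\<lambda>x. transpose_mat (F x)) S"
proof (rule eq_matI)
  fix i j assume "i < dim_row (mat_sum m n (\<lambda>x. transpose_mat (F x)) S)"
    "j < dim_col (mat_sum m n (\<lambda>x. transpose_mat (F x)) S)"
  then have ij: "i < m" "j < n" by auto
  have "transpose_mat (F x) $$ (i, j) = F x $$ (j, i)" if "x \<in> S" for x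
    using F[OF that] ij by simp
  then show "transpose_mat (mat_sum n m F S) $$ (i, j) = mat_sum m n (\<lambda>x. transpose_mat (F x)) S $$ (i, j)"
    using ij by simp
qed auto

lemma mat_sum_mult:
  fixes A :: "'b :: comm_semiring_0 mat"
  assumes A: "A \<in> carrier_mat m l" and F: "\<And>x. x \<in> S \<Longrightarrow> F x \<in> carrier_mat n m"
  shows "mat_sum n m F S * A = mat_sum n l (\<lambda>x. F x * A) S"
proof (rule eq_matI)
  fix i j assume "i < dim_row (mat_sum n l (\<lambda>x. F x * A) S)" "j < dim_col (mat_sum n l (\<lambda>x. F x * A) S)"
  then have ij: "i < n" "j < l" by auto
  have "(mat_sum n m F S * A) $$ (i, j) = (\<Sum>k<m. \<Sum>x\<in>S. F x $$ (i, k) * A $$ (k, j))"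
    using ij by (simp add: index_mult_mat_sum[OF mat_sum_carrier A ij] sum_distrib_right)
  also have "\<dots> = (\<Sum>x\<in>S. (F x * A) $$ (i, j))"
    by (subst sum.swap) (intro sum.cong refl index_mult_mat_sum[OF F A ij, symmetric])
  finally show "(mat_sum n m F S * A) $$ (i, j) = mat_sum n l (\<lambda>x. F x * A) S $$ (i, j)"
    using ij by simp
qed (use A in auto)

lemma trace_mat_sum:
  assumes "\<And>x. x \<in> S \<Longrightarrow> F x \<in> carrier_mat n n"
  shows "trace (mat_sum n n F S) = (\<Sum>x\<in>S. trace (F x))"
proof -
  have "trace (mat_sum n n F S) = (\<Sum>i<n. \<Sum>x\<in>S. F x $$ (i, i))" by (simp add: trace_def)
  also have "\<dots> = (\<Sum>x\<in>S. \<Sum>i<n. F x $$ (i, i))" by (rule sum.swap)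
  also have "\<dots> = (\<Sum>x\<in>S. trace (F x))" using assms by (auto simp: trace_def intro!: sum.cong)
  finally show ?thesis .
qed

lemma mat_sum_const:
  fixes A :: "'b :: comm_semiring_1 mat"
  assumes "A \<in> carrier_mat n m"
  shows "mat_sum n m (\<lambda>_. A) S = of_nat (card S) \<cdot>\<^sub>m A"
  using assms by (auto intro!: eq_matI)

lemma zero_mat_mult_vec [simp]:
  "x \<in> carrier_vec m \<Longrightarrow> 0\<^sub>m n m *\<^sub>v x = (0\<^sub>v n :: 'a :: semiring_0 vec)"
  by (intro eq_vecI) (auto simp: scalar_prod_def)

lemma mult_zero_vec:
  "A \<in> carrier_mat n m \<Longrightarrow> A *\<^sub>v 0\<^sub>v m = (0\<^sub>v n :: 'a :: semiring_0 vec)"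
  by (intro eq_vecI) (auto simp: scalar_prod_def)

lemma eq_zero_matI:
  fixes A :: "'a :: semiring_1 mat"
  assumes "A \<in> carrier_mat n m" "\<And>x. x \<in> carrier_vec m \<Longrightarrow> A *\<^sub>v x = 0\<^sub>v n"
  shows "A = 0\<^sub>m n m"
  using assms by (intro eq_mat_by_vecI[of A n m]) auto

lemma mult_carrier_mat3:
  "A \<in> carrier_mat n m \<Longrightarrow> B \<in> carrier_mat m l \<Longrightarrow> C \<in> carrier_mat l k \<Longrightarrow> A * B * C \<in> carrier_mat n k"
  by (intro mult_carrier_mat)

lemma minus_eq_zero_vecD:
  fixes u x :: "'a :: group_add vec"
  assumes "u \<in> carrier_vec n" "x \<in> carrier_vec n" "u - x = 0\<^sub>v n"
  shows "u = x"
proof (rule eq_vecI)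
  fix i assume "i < dim_vec x"
  then have "u $ i - x $ i = (u - x) $ i" "i < n" using assms(1,2) by auto
  then show "u $ i = x $ i" unfolding assms(3) by simp
qed (use assms in auto)

lemma minus_eq_zero_matD:
  fixes A B :: "'a :: group_add mat"
  assumes "A \<in> carrier_mat n m" "B \<in> carrier_mat n m" "A - B = 0\<^sub>m n m"
  shows "A = B"
proof (rule eq_matI)
  fix i j assume "i < dim_row B" "j < dim_col B"
  then have "A $$ (i, j) - B $$ (i, j) = (A - B) $$ (i, j)" "i < n" "j < m" using assms(1,2) by auto
  then show "A $$ (i, j) = B $$ (i, j)" unfolding assms(3) by simp
qed (use assms in auto)

lemma cancel_left_mat:
  fixes A B X :: "'a :: comm_ring_1 mat"
  assumes "A * B = 1\<^sub>m n" "A \<in> carrier_mat n m" "B \<in> carrier_mat m n" "X \<in> carrier_mat n l"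
  shows "A * (B * X) = X"
  unfolding assoc_mult_mat[OF assms(2,3,4), symmetric] assms(1) by (rule left_mult_one_mat[OF assms(4)])

lemma cancel_left_vec:
  fixes A B :: "'a :: comm_ring_1 mat"
  assumes "A * B = 1\<^sub>m n" "A \<in> carrier_mat n m" "B \<in> carrier_mat m n" "x \<in> carrier_vec n"
  shows "A *\<^sub>v (B *\<^sub>v x) = x"
  unfolding assoc_mult_mat_vec[OF assms(2,3,4), symmetric] assms(1) by (rule one_mult_mat_vec[OF assms(4)])

text \<open>
  Unlike the version with carrier sets, this form leaves no intermediate dimension for the
  simplifier to guess.
\<close>

lemma assoc_mult_mat_dim:
  fixes A B C :: "'a :: semiring_0 mat"
  assumes "dim_col A = dim_row B" "dim_col B = dim_row C"
  shows "A * B * C = A * (B * C)"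
  by (rule assoc_mult_mat[of A "dim_row A" "dim_row B" B "dim_row C" C "dim_col C"])
    (use assms in \<open>auto intro!: carrier_matI\<close>)

lemma subspace_image:
  fixes A :: "complex mat"
  assumes A: "A \<in> carrier_mat d e"
  shows "VectorSpace.subspace class_ring ((\<lambda>x. A *\<^sub>v x) ` carrier_vec e) (module_vec TYPE(complex) d)"
  unfolding subspace_vec_iff
proof (intro conjI ballI allI)
  show "(\<lambda>x. A *\<^sub>v x) ` carrier_vec e \<subseteq> carrier_vec d" using A by auto
  have "A *\<^sub>v 0\<^sub>v e = 0\<^sub>v d" by (rule mult_zero_vec[OF A])
  then show "0\<^sub>v d \<in> (\<lambda>x. A *\<^sub>v x) ` carrier_vec e" by (metis imageI zero_carrier_vec)
next
  fix v w assume "v \<in> (\<lambda>x. A *\<^sub>v x) ` carrier_vec e" "w \<in> (\<lambda>x. A *\<^sub>v x) ` carrier_vec e"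
  then obtain x y where "x \<in> carrier_vec e" "v = A *\<^sub>v x" "y \<in> carrier_vec e" "w = A *\<^sub>v y" by auto
  moreover from this have "A *\<^sub>v (x + y) = v + w" using A by (simp add: mult_add_distrib_mat_vec)
  ultimately show "v + w \<in> (\<lambda>x. A *\<^sub>v x) ` carrier_vec e" by (metis add_carrier_vec imageI)
next
  fix a v assume "v \<in> (\<lambda>x. A *\<^sub>v x) ` carrier_vec e"
  then obtain x where "x \<in> carrier_vec e" "v = A *\<^sub>v x" by auto
  moreover from this have "A *\<^sub>v (a \<cdot>\<^sub>v x) = a \<cdot>\<^sub>v v" using A by (simp add: mult_mat_vec)
  ultimately show "a \<cdot>\<^sub>v v \<in> (\<lambda>x. A *\<^sub>v x) ` carrier_vec e" by (metis smult_carrier_vec imageI)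
qed

lemma image_empty_dim:
  fixes Q :: "'a :: semiring_0 mat"
  assumes "Q \<in> carrier_mat N 0"
  shows "(\<lambda>x. Q *\<^sub>v x) ` carrier_vec 0 = {0\<^sub>v N}"
proof -
  have "Q *\<^sub>v x = 0\<^sub>v N" if "x \<in> carrier_vec 0" for x
    using that assms by (intro eq_vecI) (auto simp: scalar_prod_def)
  then have "(\<lambda>x. Q *\<^sub>v x) ` carrier_vec 0 = (\<lambda>x :: 'a vec. 0\<^sub>v N) ` carrier_vec 0" by (rule image_cong[OF refl])
  also have "\<dots> = {0\<^sub>v N}" by (rule image_constant[OF zero_carrier_vec])
  finally show ?thesis .
qed

definition unit_mat :: "nat \<Rightarrow> nat \<Rightarrow> nat \<Rightarrow> nat \<Rightarrow> complex mat" where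
  "unit_mat d e k l = mat d e (\<lambda>(i, j). if i = k \<and> j = l then 1 else 0)"

lemma unit_mat_carrier [simp]: "unit_mat d e k l \<in> carrier_mat d e"
  by (simp add: unit_mat_def)

section \<open>Schur's lemma and the orthogonality relations\<close>

locale finite_group = group G for G (structure) +
  assumes finite_carrier: "finite (carrier G)"
begin

lemma order_pos: "card (carrier G) > 0"
  using finite_carrier one_closed card_gt_0_iff by blast

lemma matrix_rep_iff:
  "matrix_rep G d \<rho> \<longleftrightarrow> (\<forall>g\<in>carrier G. \<rho> g \<in> carrier_mat d d) \<and>
    (\<forall>g\<in>carrier G. \<forall>h\<in>carrier G. \<rho> (g \<otimes> h) = \<rho> g * \<rho> h) \<and> \<rho> \<one> = 1\<^sub>m d"
proof -
  let ?R = "ring_mat TYPE(complex) d ()"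
  interpret R: ring ?R by (rule ring_mat)
  interpret U: group "units_of ?R" by (rule R.units_group)
  show ?thesis
  proof (intro iffI conjI ballI)
    assume r: "matrix_rep G d \<rho>"
    then interpret group_hom G "units_of ?R" \<rho>
      by unfold_locales (simp add: matrix_rep_def)
    show "\<rho> \<one> = 1\<^sub>m d" using hom_one by (simp add: units_of_one ring_mat_simps)
    show "\<rho> g \<in> carrier_mat d d" if "g \<in> carrier G" for g
      using hom_closed[OF that] by (auto simp: units_of_carrier Units_def ring_mat_simps)
    show "\<rho> (g \<otimes> h) = \<rho> g * \<rho> h" if "g \<in> carrier G" "h \<in> carrier G" for g h
      using hom_mult[OF that] by (simp add: units_of_mult ring_mat_simps)
  next
    assume r: "(\<forall>g\<in>carrier G. \<rho> g \<in> carrier_mat d d) \<and>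
      (\<forall>g\<in>carrier G. \<forall>h\<in>carrier G. \<rho> (g \<otimes> h) = \<rho> g * \<rho> h) \<and> \<rho> \<one> = 1\<^sub>m d"
    have "\<rho> g \<in> Units ?R" if g: "g \<in> carrier G" for g
      unfolding Units_def ring_mat_simps
      using r g inv_closed[OF g] r_inv[OF g] l_inv[OF g] by (metis (mono_tags, lifting) mem_Collect_eq)
    then show "matrix_rep G d \<rho>"
      using r by (auto simp: matrix_rep_def hom_def units_of_carrier units_of_mult ring_mat_simps)
  qed
qed

lemma matrix_repI:
  assumes "\<And>g. g \<in> carrier G \<Longrightarrow> \<rho> g \<in> carrier_mat d d"
    "\<And>g h. g \<in> carrier G \<Longrightarrow> h \<in> carrier G \<Longrightarrow> \<rho> (g \<otimes> h) = \<rho> g * \<rho> h" "\<rho> \<one> = 1\<^sub>m d"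
  shows "matrix_rep G d \<rho>"
  using assms by (simp add: matrix_rep_iff)

lemma
  assumes "matrix_rep G d \<rho>"
  shows matrix_rep_carrier: "g \<in> carrier G \<Longrightarrow> \<rho> g \<in> carrier_mat d d"
    and matrix_rep_mult: "g \<in> carrier G \<Longrightarrow> h \<in> carrier G \<Longrightarrow> \<rho> (g \<otimes> h) = \<rho> g * \<rho> h"
    and matrix_rep_one: "\<rho> \<one> = 1\<^sub>m d"
  using assms by (simp_all add: matrix_rep_iff)

lemma matrix_rep_inv:
  assumes "matrix_rep G d \<rho>" "g \<in> carrier G"
  shows "\<rho> g * \<rho> (inv g) = 1\<^sub>m d" "\<rho> (inv g) * \<rho> g = 1\<^sub>m d"
  using assms matrix_rep_mult[OF assms(1), of g "inv g"] matrix_rep_mult[OF assms(1), of "inv g" g]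
  by (simp_all add: matrix_rep_one[OF assms(1)])

lemma irreducible_repD:
  assumes "irreducible_rep G d \<rho>"
  shows "matrix_rep G d \<rho>" "d > 0"
    "invariant_subspace G d \<rho> W \<Longrightarrow> W = {0\<^sub>v d} \<or> W = carrier_vec d"
  using assms by (auto simp: irreducible_rep_def)

lemma kernel_invariant:
  assumes \<sigma>: "matrix_rep G e \<sigma>" and \<rho>: "matrix_rep G d \<rho>" and A: "A \<in> carrier_mat d e"
    and tw: "\<And>g. g \<in> carrier G \<Longrightarrow> \<rho> g * A = A * \<sigma> g"
  shows "invariant_subspace G e \<sigma> {x \<in> carrier_vec e. A *\<^sub>v x = 0\<^sub>v d}"
  unfolding invariant_subspace_def subspace_vec_iff
proof (intro conjI ballI allI)
  fix g x assume g: "g \<in> carrier G" and "x \<in> {x \<in> carrier_vec e. A *\<^sub>v x = 0\<^sub>v d}"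
  then have x: "x \<in> carrier_vec e" "A *\<^sub>v x = 0\<^sub>v d" by auto
  note c = matrix_rep_carrier[OF \<sigma> g] matrix_rep_carrier[OF \<rho> g]
  have "A *\<^sub>v (\<sigma> g *\<^sub>v x) = \<rho> g *\<^sub>v (A *\<^sub>v x)"
    
    unfolding assoc_mult_mat_vec[OF c(2) A x(1), symmetric] tw[OF g]
    by (rule assoc_mult_mat_vec[OF A c(1) x(1), symmetric])
  also have "\<dots> = 0\<^sub>v d" unfolding x(2) by (rule mult_zero_vec[OF c(2)])
  finally show "\<sigma> g *\<^sub>v x \<in> {x \<in> carrier_vec e. A *\<^sub>v x = 0\<^sub>v d}" using c x by auto
qed (use A in \<open>auto simp: mult_add_distrib_mat_vec mult_mat_vec mult_zero_vec\<close>)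

lemma image_invariant:
  assumes \<sigma>: "matrix_rep G e \<sigma>" and \<rho>: "matrix_rep G d \<rho>" and A: "A \<in> carrier_mat d e"
    and tw: "\<And>g. g \<in> carrier G \<Longrightarrow> \<rho> g * A = A * \<sigma> g"
  shows "invariant_subspace G d \<rho> ((\<lambda>x. A *\<^sub>v x) ` carrier_vec e)"
  unfolding invariant_subspace_def
proof (intro conjI ballI subspace_image[OF A])
  fix g v assume g: "g \<in> carrier G" and "v \<in> (\<lambda>x. A *\<^sub>v x) ` carrier_vec e"
  then obtain x where x: "x \<in> carrier_vec e" "v = A *\<^sub>v x" by auto
  note c = matrix_rep_carrier[OF \<sigma> g] matrix_rep_carrier[OF \<rho> g]
  have "\<rho> g *\<^sub>v v = A *\<^sub>v (\<sigma> g *\<^sub>v x)"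
    unfolding x(2) assoc_mult_mat_vec[OF c(2) A x(1), symmetric] tw[OF g]
    by (rule assoc_mult_mat_vec[OF A c(1) x(1)])
  then show "\<rho> g *\<^sub>v v \<in> (\<lambda>x. A *\<^sub>v x) ` carrier_vec e" using c x by auto
qed

text \<open>
  The image of a nonzero intertwiner is a nonzero invariant subspace, hence everything; preimages of
  the unit vectors form the columns of a right inverse.
\<close>

lemma intertwiner_surj:
  assumes \<rho>: "irreducible_rep G d \<rho>" and \<sigma>: "matrix_rep G e \<sigma>" and A: "A \<in> carrier_mat d e"
    and tw: "\<And>g. g \<in> carrier G \<Longrightarrow> \<rho> g * A = A * \<sigma> g" and ne: "A \<noteq> 0\<^sub>m d e"
  shows "\<exists>B\<in>carrier_mat e d. A * B = 1\<^sub>m d"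
proof -
  let ?W = "(\<lambda>x. A *\<^sub>v x) ` carrier_vec e"
  have "?W \<noteq> {0\<^sub>v d}"
  proof
    assume W: "?W = {0\<^sub>v d}"
    have "A = 0\<^sub>m d e"
      by (rule eq_zero_matI[OF A]) (use W in blast)
    with ne show False by simp
  qed
  then have W: "?W = carrier_vec d"
    using irreducible_repD(3)[OF \<rho> image_invariant[OF \<sigma> irreducible_repD(1)[OF \<rho>] A tw]] by blast
  have "\<exists>x. x \<in> carrier_vec e \<and> A *\<^sub>v x = unit_vec d j" for j
    using W unit_vec_carrier by (metis (no_types, lifting) imageE)
  then obtain f where f: "\<And>j. f j \<in> carrier_vec e" "\<And>j. A *\<^sub>v f j = unit_vec d j" by metis
  define B where "B = mat e d (\<lambda>(i, j). f j $ i)"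
  have B: "B \<in> carrier_mat e d" by (simp add: B_def)
  have "A * B = 1\<^sub>m d"
  proof (rule eq_matI)
    fix i j assume "i < dim_row (1\<^sub>m d :: complex mat)" "j < dim_col (1\<^sub>m d :: complex mat)"
    then have ij: "i < d" "j < d" by auto
    have "(A * B) $$ (i, j) = (A *\<^sub>v f j) $ i"
      unfolding index_mult_mat_sum[OF A B ij] index_mult_vec_sum[OF A f(1) ij(1)]
      using ij by (auto simp: B_def intro!: sum.cong)
    then show "(A * B) $$ (i, j) = (1\<^sub>m d :: complex mat) $$ (i, j)" using f(2) ij by simp
  qed (use A B in auto)
  with B show ?thesis by blast
qed

text \<open>
  Half of Schur's lemma, in the form needed for characters: a nonzero intertwiner between
  irreducible representations is invertible, so the two representations are similar.
\<close>

lemma Schur_trace: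
  assumes \<rho>: "irreducible_rep G d \<rho>" and \<sigma>: "irreducible_rep G e \<sigma>" and A: "A \<in> carrier_mat d e"
    and tw: "\<And>g. g \<in> carrier G \<Longrightarrow> \<rho> g * A = A * \<sigma> g" and ne: "A \<noteq> 0\<^sub>m d e"
    and g: "g \<in> carrier G"
  shows "trace (\<rho> g) = trace (\<sigma> g)"
proof -
  note \<rho>' = irreducible_repD(1)[OF \<rho>] and \<sigma>' = irreducible_repD(1)[OF \<sigma>]
  obtain B where B: "B \<in> carrier_mat e d" and AB: "A * B = 1\<^sub>m d"
    using intertwiner_surj[OF \<rho> \<sigma>' A tw ne] by blast
  let ?K = "{x \<in> carrier_vec e. A *\<^sub>v x = 0\<^sub>v d}"
  have "?K \<noteq> carrier_vec e"
  proof
    assume K: "?K = carrier_vec e"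
    have "A = 0\<^sub>m d e"
      by (rule eq_zero_matI[OF A]) (use K in blast)
    with ne show False by simp
  qed
  then have K: "?K = {0\<^sub>v e}"
    using irreducible_repD(3)[OF \<sigma> kernel_invariant[OF \<sigma>' \<rho>' A tw]] by blast
  have "B * A = 1\<^sub>m e"
  proof (rule eq_mat_by_vecI)
    fix x :: "complex vec" assume x: "x \<in> carrier_vec e"
    then have Ax: "A *\<^sub>v x \<in> carrier_vec d" "B *\<^sub>v (A *\<^sub>v x) \<in> carrier_vec e" using A B by auto
    have "A *\<^sub>v (B *\<^sub>v (A *\<^sub>v x)) = A *\<^sub>v x"
      using cancel_left_vec[OF AB A B Ax(1)] .
    then have "A *\<^sub>v (B *\<^sub>v (A *\<^sub>v x) - x) = 0\<^sub>v d"
      using A Ax x by (simp add: mult_minus_distrib_mat_vec[OF A])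
    then have "B *\<^sub>v (A *\<^sub>v x) - x \<in> ?K" using x Ax(2) by simp
    then have "B *\<^sub>v (A *\<^sub>v x) - x = 0\<^sub>v e" unfolding K by simp
    then have "B *\<^sub>v (A *\<^sub>v x) = x"
      using x Ax(2) minus_eq_zero_vecD by blast
    then show "B * A *\<^sub>v x = 1\<^sub>m e *\<^sub>v x" using x A B by simp
  qed (use A B in auto)
  note c = matrix_rep_carrier[OF \<rho>' g] matrix_rep_carrier[OF \<sigma>' g]
  have "trace (\<rho> g) = trace ((\<rho> g * A) * B)"
    using c A B AB by simp
  also have "\<dots> = trace (B * (A * \<sigma> g))"
    unfolding tw[OF g] using c A B by (intro trace_mult_comm[of _ d e]) auto
  also have "B * (A * \<sigma> g) = \<sigma> g"
    by (rule cancel_left_mat[OF \<open>B * A = 1\<^sub>m e\<close> B A c(2)])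
  finally show ?thesis .
qed

text \<open>
  The other half: over the complex numbers \<open>A\<close> has an eigenvalue \<open>k\<close>, and \<open>A - k\<close> is an intertwiner
  with nonzero kernel, so it vanishes. Taking traces identifies \<open>k\<close>.
\<close>

lemma Schur_scalar:
  assumes \<rho>: "irreducible_rep G d \<rho>" and A: "A \<in> carrier_mat d d"
    and tw: "\<And>g. g \<in> carrier G \<Longrightarrow> \<rho> g * A = A * \<rho> g"
  shows "A = (trace A / of_nat d) \<cdot>\<^sub>m 1\<^sub>m d"
proof -
  note \<rho>' = irreducible_repD(1)[OF \<rho>] and d = irreducible_repD(2)[OF \<rho>]
  obtain k v where v: "v \<in> carrier_vec d" "v \<noteq> 0\<^sub>v d" "A *\<^sub>v v = k \<cdot>\<^sub>v v"
    using spectrum_non_empty[OF A d] A by (auto simp: spectrum_def eigenvalue_def eigenvector_def)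
  define N where "N = A - k \<cdot>\<^sub>m 1\<^sub>m d"
  have N: "N \<in> carrier_mat d d" by (simp add: N_def minus_carrier_mat)
  have twN: "\<rho> g * N = N * \<rho> g" if g: "g \<in> carrier G" for g
  proof -
    note c = matrix_rep_carrier[OF \<rho>' g]
    have k: "k \<cdot>\<^sub>m 1\<^sub>m d \<in> carrier_mat d d" by simp
    have "\<rho> g * (k \<cdot>\<^sub>m 1\<^sub>m d) = (k \<cdot>\<^sub>m 1\<^sub>m d) * \<rho> g"
      using c by (simp add: mult_smult_distrib[OF c one_carrier_mat] mult_smult_assoc_mat[OF one_carrier_mat c])
    then show ?thesis
      unfolding N_def mult_minus_distrib_mat[OF c A k] minus_mult_distrib_mat[OF A k c] tw[OF g] by simp
  qed
  have smv: "(k \<cdot>\<^sub>m 1\<^sub>m d) *\<^sub>v x = k \<cdot>\<^sub>v x" if "x \<in> carrier_vec d" for x :: "complex vec"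
    using that by (intro eq_vecI) auto
  have Nx: "N *\<^sub>v x = A *\<^sub>v x - k \<cdot>\<^sub>v x" if x: "x \<in> carrier_vec d" for x
    using x A by (simp add: N_def minus_mult_distrib_mat_vec[OF A] smv)
  let ?K = "{x \<in> carrier_vec d. N *\<^sub>v x = 0\<^sub>v d}"
  have "v \<in> ?K" using v by (simp add: Nx)
  then have K: "?K = carrier_vec d"
    using irreducible_repD(3)[OF \<rho> kernel_invariant[OF \<rho>' \<rho>' N twN]] v by blast
  have "N = 0\<^sub>m d d"
    by (rule eq_zero_matI[OF N]) (use K in blast)
  then have Ak: "A = k \<cdot>\<^sub>m 1\<^sub>m d"
    using A unfolding N_def by (intro minus_eq_zero_matD[of A d d]) auto
  then have "trace A = k * of_nat d" by (simp add: trace_smult[of _ d] trace_one)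
  then show ?thesis using Ak d by simp
qed

text \<open>
  Averaging over the group turns an arbitrary matrix into an intertwiner. The normalising factor is
  left out.
\<close>

definition twirl :: "nat \<Rightarrow> nat \<Rightarrow> ('a \<Rightarrow> complex mat) \<Rightarrow> ('a \<Rightarrow> complex mat) \<Rightarrow> complex mat \<Rightarrow> complex mat" where
  "twirl d e \<rho> \<sigma> X = mat_sum d e (\<lambda>g. \<rho> g * X * \<sigma> (inv g)) (carrier G)"

lemma twirl_carrier [simp]: "twirl d e \<rho> \<sigma> X \<in> carrier_mat d e"
  by (simp add: twirl_def)

lemma bij_left_mult: "h \<in> carrier G \<Longrightarrow> bij_betw (\<lambda>g. h \<otimes> g) (carrier G) (carrier G)"
  by (simp add: bij_betw_def inj_on_cmult surj_const_mult)

lemma twirl_intertwines: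
  assumes \<rho>: "matrix_rep G d \<rho>" and \<sigma>: "matrix_rep G e \<sigma>" and X: "X \<in> carrier_mat d e"
    and h: "h \<in> carrier G"
  shows "\<rho> h * twirl d e \<rho> \<sigma> X = twirl d e \<rho> \<sigma> X * \<sigma> h"
proof -
  note c = matrix_rep_carrier[OF \<rho>] matrix_rep_carrier[OF \<sigma>]
  have "twirl d e \<rho> \<sigma> X * \<sigma> h = mat_sum d e (\<lambda>g. \<rho> g * X * \<sigma> (inv g) * \<sigma> h) (carrier G)"
    unfolding twirl_def using h by (intro mat_sum_mult c mult_carrier_mat3[OF c(1) X c(2)] inv_closed)
  also have "\<dots> = mat_sum d e (\<lambda>g. \<rho> (h \<otimes> g) * X * \<sigma> (inv (h \<otimes> g)) * \<sigma> h) (carrier G)"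
    by (rule mat_sum_reindex[OF bij_left_mult[OF h]])
  also have "\<dots> = mat_sum d e (\<lambda>g. \<rho> h * (\<rho> g * X * \<sigma> (inv g))) (carrier G)"
  proof (rule mat_sum_cong[OF refl])
    fix g assume g: "g \<in> carrier G"
    have "\<rho> (h \<otimes> g) * X * \<sigma> (inv (h \<otimes> g)) * \<sigma> h = \<rho> (h \<otimes> g) * X * (\<sigma> (inv (h \<otimes> g)) * \<sigma> h)"
      using c X h g by (intro assoc_mult_mat[of _ d e _ e _ e] mult_carrier_mat[of _ d d _ e]) auto
    also have "\<sigma> (inv (h \<otimes> g)) * \<sigma> h = \<sigma> (inv g)"
      using g h by (simp add: matrix_rep_mult[OF \<sigma>, symmetric] inv_mult_group m_assoc)
    also have "\<rho> (h \<otimes> g) * X * \<sigma> (inv g) = \<rho> h * (\<rho> g * X * \<sigma> (inv g))"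
      unfolding matrix_rep_mult[OF \<rho> h g] assoc_mult_mat[OF c(1)[OF h] c(1)[OF g] X]
      by (rule assoc_mult_mat[OF c(1)[OF h] mult_carrier_mat[OF c(1)[OF g] X] c(2)[OF inv_closed[OF g]]])
    finally show "\<rho> (h \<otimes> g) * X * \<sigma> (inv (h \<otimes> g)) * \<sigma> h = \<rho> h * (\<rho> g * X * \<sigma> (inv g))" .
  qed
  also have "\<dots> = \<rho> h * twirl d e \<rho> \<sigma> X"
    unfolding twirl_def by (rule mult_mat_sum[OF c(1)[OF h] mult_carrier_mat3[OF c(1) X c(2)], symmetric]) simp_all
  finally show ?thesis by simp
qed

lemma twirl_unit_mat:
  assumes \<rho>: "matrix_rep G d \<rho>" and \<sigma>: "matrix_rep G e \<sigma>"
    and i: "i < d" and j: "j < e" and k: "k < d" and l: "l < e"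
  shows "twirl d e \<rho> \<sigma> (unit_mat d e k l) $$ (i, j)
    = (\<Sum>g\<in>carrier G. \<rho> g $$ (i, k) * \<sigma> (inv g) $$ (l, j))"
proof -
  have "(\<rho> g * unit_mat d e k l * \<sigma> (inv g)) $$ (i, j) = \<rho> g $$ (i, k) * \<sigma> (inv g) $$ (l, j)"
    if g: "g \<in> carrier G" for g
  proof -
    note c = matrix_rep_carrier[OF \<rho> g] matrix_rep_carrier[OF \<sigma> inv_closed[OF g]]
    have "(\<rho> g * unit_mat d e k l) $$ (i, q) = (if q = l then \<rho> g $$ (i, k) else 0)" if "q < e" for q
    proof -
      have "(\<rho> g * unit_mat d e k l) $$ (i, q) = (\<Sum>p<d. if p = k then (if q = l then \<rho> g $$ (i, p) else 0) else 0)"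
        using i k that by (subst index_mult_mat_sum[OF c(1) unit_mat_carrier])
          (simp_all add: unit_mat_def if_distrib[of "\<lambda>x. _ * x"] if_distribR cong: if_cong)
      then show ?thesis using k by simp
    qed
    then have "(\<rho> g * unit_mat d e k l * \<sigma> (inv g)) $$ (i, j)
        = (\<Sum>q<e. if q = l then \<rho> g $$ (i, k) * \<sigma> (inv g) $$ (q, j) else 0)"
      unfolding index_mult_mat_sum[OF mult_carrier_mat[OF c(1) unit_mat_carrier] c(2) i j]
      by (intro sum.cong refl) simp
    then show ?thesis using l by simp
  qed
  then show ?thesis using i j by (simp add: twirl_def del: index_mult_mat)
qed

text \<open>
  The unnormalised inner product of two characters only sees the averages of the matrix units, which
  is how Schur's lemma enters the orthogonality relations.
\<close>

lemma sum_trace_mult_trace_inv: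
  assumes \<rho>: "matrix_rep G d \<rho>" and \<sigma>: "matrix_rep G e \<sigma>"
  shows "(\<Sum>g\<in>carrier G. trace (\<rho> g) * trace (\<sigma> (inv g)))
    = (\<Sum>i<d. \<Sum>j<e. twirl d e \<rho> \<sigma> (unit_mat d e i j) $$ (i, j))"
proof -
  have "(\<Sum>i<d. \<Sum>j<e. twirl d e \<rho> \<sigma> (unit_mat d e i j) $$ (i, j))
      = (\<Sum>i<d. \<Sum>j<e. \<Sum>g\<in>carrier G. \<rho> g $$ (i, i) * \<sigma> (inv g) $$ (j, j))"
    by (intro sum.cong refl) (simp add: twirl_unit_mat[OF \<rho> \<sigma>])
  also have "\<dots> = (\<Sum>i<d. \<Sum>g\<in>carrier G. \<rho> g $$ (i, i) * trace (\<sigma> (inv g)))"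
  proof (rule sum.cong[OF refl])
    fix i
    show "(\<Sum>j<e. \<Sum>g\<in>carrier G. \<rho> g $$ (i, i) * \<sigma> (inv g) $$ (j, j))
        = (\<Sum>g\<in>carrier G. \<rho> g $$ (i, i) * trace (\<sigma> (inv g)))"
      by (subst sum.swap) (use matrix_rep_carrier[OF \<sigma>] in
          \<open>auto simp: trace_def sum_distrib_left intro!: sum.cong\<close>)
  qed
  also have "\<dots> = (\<Sum>g\<in>carrier G. trace (\<rho> g) * trace (\<sigma> (inv g)))"
    by (subst sum.swap) (use matrix_rep_carrier[OF \<rho>] in
          \<open>auto simp: trace_def[of "\<rho> _"] sum_distrib_right intro!: sum.cong\<close>)
  finally show ?thesis by simp
qed

lemma trace_conj:
  assumes \<rho>: "matrix_rep G d \<rho>" and g: "g \<in> carrier G" and X: "X \<in> carrier_mat d d"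
  shows "trace (\<rho> g * X * \<rho> (inv g)) = trace X"
proof -
  note c = matrix_rep_carrier[OF \<rho> g] matrix_rep_carrier[OF \<rho> inv_closed[OF g]]
  have "trace (\<rho> g * X * \<rho> (inv g)) = trace (\<rho> (inv g) * (\<rho> g * X))"
    using c X by (intro trace_mult_comm[of _ d d]) auto
  also have "\<rho> (inv g) * (\<rho> g * X) = X"
    by (rule cancel_left_mat[OF matrix_rep_inv(2)[OF \<rho> g] c(2,1) X])
  finally show ?thesis .
qed

lemma twirl_irreducible:
  assumes \<rho>: "irreducible_rep G d \<rho>" and X: "X \<in> carrier_mat d d"
  shows "twirl d d \<rho> \<rho> X = (of_nat (card (carrier G)) * trace X / of_nat d) \<cdot>\<^sub>m 1\<^sub>m d"
proof -
  note \<rho>' = irreducible_repD(1)[OF \<rho>]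
  have "trace (twirl d d \<rho> \<rho> X) = (\<Sum>g\<in>carrier G. trace (\<rho> g * X * \<rho> (inv g)))"
    unfolding twirl_def by (intro trace_mat_sum mult_carrier_mat3[OF _ X] matrix_rep_carrier[OF \<rho>'] inv_closed)
  also have "\<dots> = of_nat (card (carrier G)) * trace X"
    using trace_conj[OF \<rho>' _ X] by simp
  finally show ?thesis
    using Schur_scalar[OF \<rho> twirl_carrier twirl_intertwines[OF \<rho>' \<rho>' X]] by simp
qed

lemma coefficient_orthogonality:
  assumes \<rho>: "irreducible_rep G d \<rho>" and ij: "i < d" "j < d" "k < d" "l < d"
  shows "(\<Sum>g\<in>carrier G. \<rho> g $$ (i, k) * \<rho> (inv g) $$ (l, j))
    = (if i = j \<and> k = l then of_nat (card (carrier G)) / of_nat d else 0)"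
proof -
  have "trace (unit_mat d d k l) = (if k = l then 1 else 0)"
    using ij by (auto simp: trace_def unit_mat_def)
  then show ?thesis
    using twirl_unit_mat[OF irreducible_repD(1)[OF \<rho>] irreducible_repD(1)[OF \<rho>] ij, symmetric] ij
    by (simp add: twirl_irreducible[OF \<rho>])
qed

text \<open>
  Burnside's theorem with explicit coefficients: the matrices of an irreducible representation span
  the full matrix algebra. The coefficient of \<open>\<rho> g\<close> inherits every symmetry that \<open>P\<close> has, which is
  what the transfer of skew forms relies on.
\<close>

lemma irreducible_expansion:
  assumes \<rho>: "irreducible_rep G d \<rho>" and P: "P \<in> carrier_mat d d"
  shows "P = (of_nat d / of_nat (card (carrier G))) \<cdot>\<^sub>m
    mat_sum d d (\<lambda>g. trace (P * \<rho> (inv g)) \<cdot>\<^sub>m \<rho> g) (carrier G)"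
proof (rule eq_matI)
  let ?M = "mat_sum d d (\<lambda>g. trace (P * \<rho> (inv g)) \<cdot>\<^sub>m \<rho> g) (carrier G)"
  let ?c = "of_nat d / of_nat (card (carrier G)) :: complex"
  note \<rho>' = irreducible_repD(1)[OF \<rho>] and d = irreducible_repD(2)[OF \<rho>]
  note c = matrix_rep_carrier[OF \<rho>']
  fix i k assume "i < dim_row (?c \<cdot>\<^sub>m ?M)" "k < dim_col (?c \<cdot>\<^sub>m ?M)"
  then have ik: "i < d" "k < d" by auto
  have "?M $$ (i, k) = (\<Sum>g\<in>carrier G. trace (P * \<rho> (inv g)) * \<rho> g $$ (i, k))"
    using ik by (auto intro!: sum.cong simp: carrier_matD[OF c])
  also have "\<dots> = (\<Sum>g\<in>carrier G. \<Sum>j<d. \<Sum>l<d. P $$ (j, l) * (\<rho> g $$ (i, k) * \<rho> (inv g) $$ (l, j)))"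
  proof (rule sum.cong[OF refl])
    fix g assume g: "g \<in> carrier G"
    have "trace (P * \<rho> (inv g)) = (\<Sum>j<d. \<Sum>l<d. P $$ (j, l) * \<rho> (inv g) $$ (l, j))"
      unfolding trace_def index_mult_mat(2) carrier_matD(1)[OF P]
      by (intro sum.cong refl index_mult_mat_sum[OF P c[OF inv_closed[OF g]]]) auto
    then show "trace (P * \<rho> (inv g)) * \<rho> g $$ (i, k)
        = (\<Sum>j<d. \<Sum>l<d. P $$ (j, l) * (\<rho> g $$ (i, k) * \<rho> (inv g) $$ (l, j)))"
      by (simp add: sum_distrib_right sum_distrib_left mult_ac)
  qed
  also have "\<dots> = (\<Sum>j<d. \<Sum>l<d. P $$ (j, l) * (\<Sum>g\<in>carrier G. \<rho> g $$ (i, k) * \<rho> (inv g) $$ (l, j)))"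
    unfolding sum_distrib_left
    by (subst sum.swap, rule sum.cong[OF refl], rule sum.swap)
  also have "\<dots> = (\<Sum>j<d. \<Sum>l<d. if l = k then (if j = i then P $$ (j, l) / ?c else 0) else 0)"
    using ik by (intro sum.cong refl) (auto simp: coefficient_orthogonality[OF \<rho>])
  also have "\<dots> = P $$ (i, k) / ?c" using ik by simp
  finally show "P $$ (i, k) = (?c \<cdot>\<^sub>m ?M) $$ (i, k)" using ik d order_pos by simp
qed (use P in auto)

lemma Irr_orthogonality:
  assumes "\<chi> \<in> Irr G" "\<psi> \<in> Irr G"
  shows "(\<Sum>g\<in>carrier G. \<chi> g * \<psi> (inv g)) = (if \<chi> = \<psi> then of_nat (card (carrier G)) else 0)"
proof -
  obtain d \<rho> where \<rho>: "irreducible_rep G d \<rho>" and \<chi>: "\<chi> = character G \<rho>"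
    using assms(1) unfolding Irr_def by blast
  obtain e \<sigma> where \<sigma>: "irreducible_rep G e \<sigma>" and \<psi>: "\<psi> = character G \<sigma>"
    using assms(2) unfolding Irr_def by blast
  note \<rho>' = irreducible_repD(1)[OF \<rho>] and \<sigma>' = irreducible_repD(1)[OF \<sigma>]
  show ?thesis
  proof (cases "\<chi> = \<psi>")
    case True
    have "(\<Sum>g\<in>carrier G. \<chi> g * \<psi> (inv g)) = (\<Sum>g\<in>carrier G. trace (\<rho> g) * trace (\<rho> (inv g)))"
      using True unfolding \<chi> by (auto simp: character_def intro!: sum.cong)
    also have "\<dots> = (\<Sum>i<d. \<Sum>j<d. if i = j then of_nat (card (carrier G)) / of_nat d else 0)"
      unfolding sum_trace_mult_trace_inv[OF \<rho>' \<rho>']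
      by (intro sum.cong refl) (auto simp: twirl_unit_mat[OF \<rho>' \<rho>'] coefficient_orthogonality[OF \<rho>])
    also have "\<dots> = of_nat (card (carrier G))" using irreducible_repD(2)[OF \<rho>] by simp
    finally show ?thesis using True by simp
  next
    case False
    have "\<exists>g\<in>carrier G. trace (\<rho> g) \<noteq> trace (\<sigma> g)"
    proof (rule ccontr)
      assume "\<not> ?thesis"
      then have "character G \<rho> = character G \<sigma>" unfolding character_def by (intro restrict_ext) simp
      then show False using False \<chi> \<psi> by simp
    qed
    then obtain g where g: "g \<in> carrier G" "trace (\<rho> g) \<noteq> trace (\<sigma> g)" by blast
    have "twirl d e \<rho> \<sigma> X = 0\<^sub>m d e" if X: "X \<in> carrier_mat d e" for X
      using Schur_trace[OF \<rho> \<sigma> twirl_carrier twirl_intertwines[OF \<rho>' \<sigma>' X] _ g(1)] g(2) by blast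
    then have "(\<Sum>g\<in>carrier G. trace (\<rho> g) * trace (\<sigma> (inv g))) = 0"
      unfolding sum_trace_mult_trace_inv[OF \<rho>' \<sigma>'] by simp
    then show ?thesis using False unfolding \<chi> \<psi> by (simp add: character_def)
  qed
qed

section \<open>Irreducible constituents\<close>

text \<open>
  Every nonzero invariant subspace contains an irreducible constituent \<open>\<sigma>\<close> that is a direct summand:
  \<open>Q\<close> embeds it and \<open>C\<close> is an equivariant retraction. A frame of least positive size among those with
  invariant image inside \<open>W\<close> is irreducible; averaging its left inverse makes it equivariant
  (Maschke).
\<close>

lemma irreducible_subrep:
  assumes R: "matrix_rep G N R" and W: "invariant_subspace G N R W" and W0: "W \<noteq> {0\<^sub>v N}"
  shows "\<exists>d \<sigma> Q C. irreducible_rep G d \<sigma> \<and> Q \<in> carrier_mat N d \<and> C \<in> carrier_mat d N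
    \<and> C * Q = 1\<^sub>m d \<and> (\<forall>g\<in>carrier G. R g * Q = Q * \<sigma> g) \<and> (\<forall>g\<in>carrier G. C * R g = \<sigma> g * C)
    \<and> (\<forall>x\<in>carrier_vec d. Q *\<^sub>v x \<in> W)"
proof -
  define F where "F k \<longleftrightarrow> 0 < k \<and> (\<exists>Q C. Q \<in> carrier_mat N k \<and> C \<in> carrier_mat k N \<and> C * Q = 1\<^sub>m k
    \<and> invariant_subspace G N R ((\<lambda>x. Q *\<^sub>v x) ` carrier_vec k) \<and> (\<lambda>x. Q *\<^sub>v x) ` carrier_vec k \<subseteq> W)" for k
  note Rc = matrix_rep_carrier[OF R]
  have frame: "\<exists>k Q C. 0 < k \<and> Q \<in> carrier_mat d k \<and> C \<in> carrier_mat k d \<and> C * Q = 1\<^sub>m k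
      \<and> W' = (\<lambda>x. Q *\<^sub>v x) ` carrier_vec k"
    if "invariant_subspace G d \<rho> W'" "W' \<noteq> {0\<^sub>v d}" for d \<rho> W'
  proof -
    obtain k Q C where *: "Q \<in> carrier_mat d k" "C \<in> carrier_mat k d" "C * Q = 1\<^sub>m k"
      "W' = (\<lambda>x. Q *\<^sub>v x) ` carrier_vec k"
      using \<open>invariant_subspace G d \<rho> W'\<close> subspace_frame unfolding invariant_subspace_def by metis
    then have "k \<noteq> 0" using image_empty_dim \<open>W' \<noteq> {0\<^sub>v d}\<close> by metis
    with * show ?thesis by blast
  qed
  have "\<exists>k. F k" unfolding F_def using frame[OF W W0] W by blast
  then have "F (LEAST k. F k)" by (rule LeastI_ex)
  then obtain k where "F k" and min: "\<And>k'. F k' \<Longrightarrow> k \<le> k'" using Least_le by blast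
  then obtain Q C where k: "0 < k" and Q: "Q \<in> carrier_mat N k" and C: "C \<in> carrier_mat k N"
    and CQ: "C * Q = 1\<^sub>m k" and inv: "invariant_subspace G N R ((\<lambda>x. Q *\<^sub>v x) ` carrier_vec k)"
    and QW: "(\<lambda>x. Q *\<^sub>v x) ` carrier_vec k \<subseteq> W"
    unfolding F_def by blast
  define \<sigma> where "\<sigma> g = C * (R g * Q)" for g
  have \<sigma>c: "\<sigma> g \<in> carrier_mat k k" if "g \<in> carrier G" for g
    unfolding \<sigma>_def by (rule mult_carrier_mat[OF C mult_carrier_mat[OF Rc[OF that] Q]])
  have RQ: "R g * Q = Q * \<sigma> g" if g: "g \<in> carrier G" for g
  proof (rule eq_mat_by_vecI[OF mult_carrier_mat[OF Rc[OF g] Q] mult_carrier_mat[OF Q \<sigma>c[OF g]]])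
    fix x :: "complex vec" assume x: "x \<in> carrier_vec k"
    have "R g *\<^sub>v (Q *\<^sub>v x) \<in> (\<lambda>x. Q *\<^sub>v x) ` carrier_vec k"
      using inv g x unfolding invariant_subspace_def by blast
    then obtain y where y: "y \<in> carrier_vec k" and eq: "R g *\<^sub>v (Q *\<^sub>v x) = Q *\<^sub>v y" by blast
    have RQx: "(R g * Q) *\<^sub>v x = Q *\<^sub>v y" using eq unfolding assoc_mult_mat_vec[OF Rc[OF g] Q x] .
    have "\<sigma> g *\<^sub>v x = y"
      unfolding \<sigma>_def assoc_mult_mat_vec[OF C mult_carrier_mat[OF Rc[OF g] Q] x] RQx
      by (rule cancel_left_vec[OF CQ C Q y])
    then show "(R g * Q) *\<^sub>v x = (Q * \<sigma> g) *\<^sub>v x"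
      unfolding RQx assoc_mult_mat_vec[OF Q \<sigma>c[OF g] x] by simp
  qed
  have \<sigma>: "matrix_rep G k \<sigma>"
  proof (rule matrix_repI[OF \<sigma>c])
    fix g h assume g: "g \<in> carrier G" and h: "h \<in> carrier G"
    have "\<sigma> (g \<otimes> h) = C * (R g * (R h * Q))"
      unfolding \<sigma>_def matrix_rep_mult[OF R g h] assoc_mult_mat[OF Rc[OF g] Rc[OF h] Q] ..
    also have "\<dots> = C * ((R g * Q) * \<sigma> h)"
      unfolding RQ[OF h] assoc_mult_mat[OF Rc[OF g] Q \<sigma>c[OF h]] ..
    also have "\<dots> = \<sigma> g * \<sigma> h"
      unfolding \<sigma>_def[of g] by (rule assoc_mult_mat[OF C mult_carrier_mat[OF Rc[OF g] Q] \<sigma>c[OF h], symmetric])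
    finally show "\<sigma> (g \<otimes> h) = \<sigma> g * \<sigma> h" .
  next
    show "\<sigma> \<one> = 1\<^sub>m k" unfolding \<sigma>_def matrix_rep_one[OF R] left_mult_one_mat[OF Q] by (rule CQ)
  qed
  have "irreducible_rep G k \<sigma>"
    unfolding irreducible_rep_def
  proof (intro conjI allI impI)
    fix W' assume W': "invariant_subspace G k \<sigma> W'"
    show "W' = {0\<^sub>v k} \<or> W' = carrier_vec k"
    proof (rule disjCI)
      assume nf: "W' \<noteq> carrier_vec k"
      show "W' = {0\<^sub>v k}"
      proof (rule ccontr)
        assume "W' \<noteq> {0\<^sub>v k}"
        from frame[OF W' this] obtain k1 Q1 C1 where k1: "0 < k1" and Q1: "Q1 \<in> carrier_mat k k1"
          and C1: "C1 \<in> carrier_mat k1 k" and CQ1: "C1 * Q1 = 1\<^sub>m k1"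
          and W1: "W' = (\<lambda>x. Q1 *\<^sub>v x) ` carrier_vec k1" by blast
        have QQ1: "Q * Q1 \<in> carrier_mat N k1" by (rule mult_carrier_mat[OF Q Q1])
        have im: "(\<lambda>x. (Q * Q1) *\<^sub>v x) ` carrier_vec k1 = (\<lambda>x. Q *\<^sub>v x) ` W'"
          unfolding W1 image_image by (intro image_cong refl assoc_mult_mat_vec[OF Q Q1])
        have W'c: "W' \<subseteq> carrier_vec k" using W' unfolding invariant_subspace_def subspace_vec_iff by blast
        have "F k1"
          unfolding F_def
        proof (intro conjI exI)
          show "C1 * C \<in> carrier_mat k1 N" by (rule mult_carrier_mat[OF C1 C])
          show "C1 * C * (Q * Q1) = 1\<^sub>m k1"
            unfolding assoc_mult_mat[OF C1 C QQ1] cancel_left_mat[OF CQ C Q Q1] by (rule CQ1)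
          show "invariant_subspace G N R ((\<lambda>x. (Q * Q1) *\<^sub>v x) ` carrier_vec k1)"
            unfolding invariant_subspace_def
          proof (intro conjI ballI subspace_image[OF QQ1])
            fix g w assume g: "g \<in> carrier G" and "w \<in> (\<lambda>x. (Q * Q1) *\<^sub>v x) ` carrier_vec k1"
            then obtain x where x: "x \<in> W'" and w: "w = Q *\<^sub>v x" unfolding im by blast
            then have xc: "x \<in> carrier_vec k" using W'c by blast
            have "R g *\<^sub>v w = Q *\<^sub>v (\<sigma> g *\<^sub>v x)"
              unfolding w assoc_mult_mat_vec[OF Rc[OF g] Q xc, symmetric] RQ[OF g]
              by (rule assoc_mult_mat_vec[OF Q \<sigma>c[OF g] xc])
            moreover have "\<sigma> g *\<^sub>v x \<in> W'" using W' g x unfolding invariant_subspace_def by blast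
            ultimately show "R g *\<^sub>v w \<in> (\<lambda>x. (Q * Q1) *\<^sub>v x) ` carrier_vec k1" unfolding im by blast
          qed
          show "(\<lambda>x. (Q * Q1) *\<^sub>v x) ` carrier_vec k1 \<subseteq> W" unfolding im using QW W'c by blast
        qed (use k1 QQ1 in auto)
        then have "k \<le> k1" by (rule min)
        moreover have "k1 \<le> k" by (rule dim_le_of_one_mat[OF C1 Q1 CQ1])
        ultimately have eq: "k1 = k" by simp
        have "Q1 * C1 = 1\<^sub>m k"
          using mat_mult_left_right_inverse[of C1 k Q1] C1 Q1 CQ1 unfolding eq by blast
        then have "x \<in> W'" if "x \<in> carrier_vec k" for x
          using cancel_left_vec[OF _ Q1 C1 that] that C1 unfolding W1 eq
          by (metis (no_types, lifting) imageI mult_mat_vec_carrier)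
        then show False using nf W'c by blast
      qed
    qed
  qed (use \<sigma> k in auto)
  let ?n = "of_nat (card (carrier G)) :: complex"
  define D where "D = (1 / ?n) \<cdot>\<^sub>m twirl k N \<sigma> R C"
  have T: "twirl k N \<sigma> R C \<in> carrier_mat k N" by simp
  then have D: "D \<in> carrier_mat k N" by (simp add: D_def)
  have "D * R g = \<sigma> g * D" if g: "g \<in> carrier G" for g
    unfolding D_def mult_smult_assoc_mat[OF T Rc[OF g]] mult_smult_distrib[OF \<sigma>c[OF g] T]
      twirl_intertwines[OF \<sigma> R C g] ..
  moreover have "D * Q = 1\<^sub>m k"
  proof -
    have "twirl k N \<sigma> R C * Q = mat_sum k k (\<lambda>g. \<sigma> g * C * R (inv g) * Q) (carrier G)"
      unfolding twirl_def by (intro mat_sum_mult Q mult_carrier_mat3[OF \<sigma>c C Rc] inv_closed)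
    also have "\<dots> = mat_sum k k (\<lambda>g. 1\<^sub>m k) (carrier G)"
    proof (rule mat_sum_cong[OF refl])
      fix g assume g: "g \<in> carrier G"
      note i = inv_closed[OF g]
      have "\<sigma> g * C * R (inv g) * Q = \<sigma> g * C * (Q * \<sigma> (inv g))"
        unfolding assoc_mult_mat[OF mult_carrier_mat[OF \<sigma>c[OF g] C] Rc[OF i] Q] RQ[OF i] ..
      also have "\<dots> = \<sigma> g * \<sigma> (inv g)"
        unfolding assoc_mult_mat[OF \<sigma>c[OF g] C mult_carrier_mat[OF Q \<sigma>c[OF i]]]
          cancel_left_mat[OF CQ C Q \<sigma>c[OF i]] ..
      finally show "\<sigma> g * C * R (inv g) * Q = 1\<^sub>m k" unfolding matrix_rep_inv(1)[OF \<sigma> g] .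
    qed
    also have "\<dots> = ?n \<cdot>\<^sub>m 1\<^sub>m k" by (rule mat_sum_const) simp
    finally show ?thesis
      using order_pos unfolding D_def mult_smult_assoc_mat[OF T Q] by (auto intro!: eq_matI)
  qed
  ultimately show ?thesis using \<open>irreducible_rep G k \<sigma>\<close> Q D RQ QW by blast
qed

section \<open>Completeness and finiteness of the irreducible characters\<close>

definition regular_rep :: "(nat \<Rightarrow> 'a) \<Rightarrow> 'a \<Rightarrow> complex mat" where
  "regular_rep e g = mat (card (carrier G)) (card (carrier G))
    (\<lambda>(i, j). if e i = g \<otimes> e j then 1 else 0)"

text \<open>
  The permutation matrices of left multiplication, with the group enumerated by \<open>e\<close>.
\<close>

lemma matrix_rep_regular:
  assumes e: "bij_betw e {..<card (carrier G)} (carrier G)"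
  shows "matrix_rep G (card (carrier G)) (regular_rep e)"
proof (rule matrix_repI)
  let ?n = "card (carrier G)"
  have ec: "e i \<in> carrier G" if "i < ?n" for i using e that unfolding bij_betw_def by blast
  have inj: "e i = e j \<longleftrightarrow> i = j" if "i < ?n" "j < ?n" for i j
    using e that unfolding bij_betw_def inj_on_def by blast
  show c: "regular_rep e g \<in> carrier_mat ?n ?n" for g by (simp add: regular_rep_def)
  show "regular_rep e \<one> = 1\<^sub>m ?n"
    by (rule eq_matI) (simp_all add: regular_rep_def ec inj)
  fix g h assume g: "g \<in> carrier G" and h: "h \<in> carrier G"
  show "regular_rep e (g \<otimes> h) = regular_rep e g * regular_rep e h"
  proof (rule eq_matI)
    fix i j assume "i < dim_row (regular_rep e g * regular_rep e h)" "j < dim_col (regular_rep e g * regular_rep e h)"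
    then have ij: "i < ?n" "j < ?n" using c by (auto simp: regular_rep_def)
    have "h \<otimes> e j \<in> carrier G" using h ec ij by simp
    then obtain k where k: "k < ?n" "e k = h \<otimes> e j" using e unfolding bij_betw_def by (metis imageE lessThan_iff)
    have "(regular_rep e g * regular_rep e h) $$ (i, j)
        = (\<Sum>l<?n. if l = k then (if e i = g \<otimes> e l then 1 else 0) else 0)"
      unfolding index_mult_mat_sum[OF c c ij]
    proof (intro sum.cong refl)
      fix l assume "l \<in> {..<?n}"
      then have l: "l < ?n" by simp
      have "(e l = h \<otimes> e j) = (l = k)" unfolding k(2)[symmetric] by (rule inj[OF l k(1)])
      then show "regular_rep e g $$ (i, l) * regular_rep e h $$ (l, j)
          = (if l = k then (if e i = g \<otimes> e l then 1 else 0) else 0)"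
        using l ij by (simp add: regular_rep_def)
    qed
    also have "\<dots> = (if e i = g \<otimes> (h \<otimes> e j) then 1 else 0)" using k by simp
    finally show "regular_rep e (g \<otimes> h) $$ (i, j) = (regular_rep e g * regular_rep e h) $$ (i, j)"
      using ij by (simp add: regular_rep_def m_assoc[OF g h ec[OF ij(2)]])
  qed (use c in \<open>auto simp: regular_rep_def\<close>)
qed

lemma bij_conj: "h \<in> carrier G \<Longrightarrow> bij_betw (\<lambda>g. inv h \<otimes> g \<otimes> h) (carrier G) (carrier G)"
proof -
  assume h: "h \<in> carrier G"
  have "h \<otimes> (inv h \<otimes> x) = x" "inv h \<otimes> (h \<otimes> x) = x" if "x \<in> carrier G" for x
    using h that by (simp_all add: m_assoc[symmetric])
  then show ?thesis
    using h by (intro bij_betwI[of _ _ _ "\<lambda>g. h \<otimes> g \<otimes> inv h"]) (simp_all add: m_assoc)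
qed

text \<open>
  A class function \<open>f\<close> acts on each representation \<open>R\<close> through \<open>\<Sum>g. f g * R (inv g)\<close>, which commutes
  with \<open>R\<close>. On an irreducible representation it is a scalar, and orthogonality says that its trace is
  zero. If it acted by \<open>A \<noteq> 0\<close> on the regular representation, the image of \<open>A\<close> would contain an
  irreducible constituent with retraction \<open>C\<close>; but \<open>C * A\<close> factors through the action on that
  constituent, so it is zero, while \<open>C\<close> does not vanish on the image of \<open>A\<close>. Hence \<open>A = 0\<close>, and the
  column of \<open>A\<close> indexed by the neutral element lists all values of \<open>f\<close>.
\<close>

lemma class_function_eq_zero:
  assumes cl: "\<And>g h. g \<in> carrier G \<Longrightarrow> h \<in> carrier G \<Longrightarrow> f (inv h \<otimes> g \<otimes> h) = f g"
    and orth: "\<And>\<chi>. \<chi> \<in> Irr G \<Longrightarrow> (\<Sum>g\<in>carrier G. f g * \<chi> (inv g)) = (0 :: complex)"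
    and x: "x \<in> carrier G"
  shows "f x = 0"
proof -
  define act where "act d R = mat_sum d d (\<lambda>g. f g \<cdot>\<^sub>m R (inv g)) (carrier G)" for d R
  have act_c: "act d R \<in> carrier_mat d d" for d R by (simp add: act_def)
  have act_comm: "R h * act d R = act d R * R h" if R: "matrix_rep G d R" and h: "h \<in> carrier G" for d R h
  proof -
    note Rc = matrix_rep_carrier[OF R]
    have sc: "f g \<cdot>\<^sub>m R (inv g) \<in> carrier_mat d d" if "g \<in> carrier G" for g
      using Rc[OF inv_closed[OF that]] by simp
    have "R h * act d R = mat_sum d d (\<lambda>g. R h * (f g \<cdot>\<^sub>m R (inv g))) (carrier G)"
      unfolding act_def by (rule mult_mat_sum[OF Rc[OF h] sc])
    also have "\<dots> = mat_sum d d (\<lambda>g. R h * (f (inv h \<otimes> g \<otimes> h) \<cdot>\<^sub>m R (inv (inv h \<otimes> g \<otimes> h)))) (carrier G)"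
      by (rule mat_sum_reindex[OF bij_conj[OF h]])
    also have "\<dots> = mat_sum d d (\<lambda>g. (f g \<cdot>\<^sub>m R (inv g)) * R h) (carrier G)"
    proof (rule mat_sum_cong[OF refl])
      fix g assume g: "g \<in> carrier G"
      have i: "inv (inv h \<otimes> g \<otimes> h) \<in> carrier G" using g h by simp
      have e: "h \<otimes> inv (inv h \<otimes> g \<otimes> h) = inv g \<otimes> h"
        using g h by (simp add: inv_mult_group m_assoc[symmetric])
      show "R h * (f (inv h \<otimes> g \<otimes> h) \<cdot>\<^sub>m R (inv (inv h \<otimes> g \<otimes> h))) = (f g \<cdot>\<^sub>m R (inv g)) * R h"
        unfolding cl[OF g h] mult_smult_distrib[OF Rc[OF h] Rc[OF i]]
          mult_smult_assoc_mat[OF Rc[OF inv_closed[OF g]] Rc[OF h]]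
          matrix_rep_mult[OF R h i, symmetric] matrix_rep_mult[OF R inv_closed[OF g] h, symmetric] e ..
    qed
    also have "\<dots> = act d R * R h"
      unfolding act_def by (rule mat_sum_mult[OF Rc[OF h] sc, symmetric])
    finally show ?thesis .
  qed
  have act_irr: "act d \<sigma> = 0\<^sub>m d d" if \<sigma>: "irreducible_rep G d \<sigma>" for d \<sigma>
  proof -
    note \<sigma>' = irreducible_repD(1)[OF \<sigma>]
    note c = matrix_rep_carrier[OF \<sigma>']
    have "trace (act d \<sigma>) = (\<Sum>g\<in>carrier G. trace (f g \<cdot>\<^sub>m \<sigma> (inv g)))"
      unfolding act_def by (rule trace_mat_sum) (use c[OF inv_closed] in simp)
    also have "\<dots> = (\<Sum>g\<in>carrier G. f g * character G \<sigma> (inv g))"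
      by (intro sum.cong refl) (simp add: trace_smult[OF c] character_def)
    also have "\<dots> = 0" by (rule orth) (use \<sigma> in \<open>auto simp: Irr_def\<close>)
    finally have "act d \<sigma> = 0 \<cdot>\<^sub>m 1\<^sub>m d"
      using Schur_scalar[OF \<sigma> act_c act_comm[OF \<sigma>']] by simp
    then show ?thesis by (auto intro!: eq_matI)
  qed
  let ?n = "card (carrier G)"
  obtain e where e: "bij_betw e {..<?n} (carrier G)"
    using ex_bij_betw_nat_finite[OF finite_carrier] by (auto simp: atLeast0LessThan)
  define R where "R = regular_rep e"
  have R: "matrix_rep G ?n R" unfolding R_def by (rule matrix_rep_regular[OF e])
  define A where "A = act ?n R"
  have A: "A \<in> carrier_mat ?n ?n" unfolding A_def by (rule act_c)
  have "A = 0\<^sub>m ?n ?n"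
  proof (rule ccontr)
    assume ne: "A \<noteq> 0\<^sub>m ?n ?n"
    let ?W = "(\<lambda>x. A *\<^sub>v x) ` carrier_vec ?n"
    have inv: "invariant_subspace G ?n R ?W"
      by (rule image_invariant[OF R R A]) (simp add: A_def act_comm[OF R])
    have "?W \<noteq> {0\<^sub>v ?n}" using eq_zero_matI[OF A] ne by blast
    from irreducible_subrep[OF R inv this] obtain d \<sigma> Q C where \<sigma>: "irreducible_rep G d \<sigma>"
      and Q: "Q \<in> carrier_mat ?n d" and C: "C \<in> carrier_mat d ?n" and CQ: "C * Q = 1\<^sub>m d"
      and CR: "\<And>g. g \<in> carrier G \<Longrightarrow> C * R g = \<sigma> g * C" and QW: "\<And>x. x \<in> carrier_vec d \<Longrightarrow> Q *\<^sub>v x \<in> ?W"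
      by blast
    note Rc = matrix_rep_carrier[OF R] and \<sigma>c = matrix_rep_carrier[OF irreducible_repD(1)[OF \<sigma>]]
    have "C * A = mat_sum d ?n (\<lambda>g. C * (f g \<cdot>\<^sub>m R (inv g))) (carrier G)"
      unfolding A_def act_def by (rule mult_mat_sum[OF C]) (use Rc[OF inv_closed] in simp)
    also have "\<dots> = mat_sum d ?n (\<lambda>g. (f g \<cdot>\<^sub>m \<sigma> (inv g)) * C) (carrier G)"
    proof (rule mat_sum_cong[OF refl])
      fix g assume g: "g \<in> carrier G"
      note i = inv_closed[OF g]
      show "C * (f g \<cdot>\<^sub>m R (inv g)) = (f g \<cdot>\<^sub>m \<sigma> (inv g)) * C"
        unfolding mult_smult_distrib[OF C Rc[OF i]] mult_smult_assoc_mat[OF \<sigma>c[OF i] C] CR[OF i] ..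
    qed
    also have "\<dots> = act d \<sigma> * C"
      unfolding act_def by (rule mat_sum_mult[OF C, symmetric]) (use \<sigma>c[OF inv_closed] in simp)
    also have "\<dots> = 0\<^sub>m d ?n" unfolding act_irr[OF \<sigma>] by (rule left_mult_zero_mat[OF C])
    finally have CA: "C * A = 0\<^sub>m d ?n" .
    have u: "unit_vec d 0 \<in> carrier_vec d" by simp
    obtain y where y: "y \<in> carrier_vec ?n" "Q *\<^sub>v unit_vec d 0 = A *\<^sub>v y" using QW[OF u] by blast
    have "unit_vec d 0 = C *\<^sub>v (Q *\<^sub>v unit_vec d 0)" by (rule cancel_left_vec[OF CQ C Q u, symmetric])
    also have "\<dots> = (C * A) *\<^sub>v y" unfolding y(2) by (rule assoc_mult_mat_vec[OF C A y(1), symmetric])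
    also have "\<dots> = 0\<^sub>v d" unfolding CA using y(1) by simp
    finally show False using unit_vec_nonzero[where 'a = complex, OF irreducible_repD(2)[OF \<sigma>]] by simp
  qed
  moreover obtain i where i: "i < ?n" "e i = inv x"
    using e inv_closed[OF x] unfolding bij_betw_def by (metis imageE lessThan_iff)
  moreover obtain j where j: "j < ?n" "e j = \<one>"
    using e one_closed unfolding bij_betw_def by (metis imageE lessThan_iff)
  moreover have "A $$ (i, j) = f x"
  proof -
    have "A $$ (i, j) = (\<Sum>g\<in>carrier G. if g = x then f g else 0)"
      using i j x by (auto simp: A_def act_def R_def regular_rep_def intro!: sum.cong)
    then show ?thesis using x finite_carrier by simp
  qed
  ultimately show ?thesis by simp
qed

lemma Irr_class_function:
  assumes \<chi>: "\<chi> \<in> Irr G" and g: "g \<in> carrier G" and h: "h \<in> carrier G"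
  shows "\<chi> (inv h \<otimes> g \<otimes> h) = \<chi> g"
proof -
  obtain d \<rho> where \<rho>: "irreducible_rep G d \<rho>" and \<chi>\<rho>: "\<chi> = character G \<rho>" using \<chi> unfolding Irr_def by blast
  note \<rho>' = irreducible_repD(1)[OF \<rho>]
  note c = matrix_rep_carrier[OF \<rho>']
  have "trace (\<rho> (inv h) * \<rho> g * \<rho> (inv (inv h))) = trace (\<rho> g)"
    by (rule trace_conj[OF \<rho>' inv_closed[OF h] c[OF g]])
  then show ?thesis using g h by (simp add: \<chi>\<rho> character_def matrix_rep_mult[OF \<rho>'])
qed

text \<open>
  By orthogonality, any \<open>m\<close> irreducible characters give a factorisation of the \<open>m \<times> m\<close> identity
  matrix through a space of dimension \<open>|G|\<close>.
\<close>

lemma finite_Irr: "finite (Irr G)"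
proof (rule ccontr)
  assume "infinite (Irr G)"
  let ?n = "card (carrier G)"
  let ?m = "Suc ?n"
  obtain F where F: "F \<subseteq> Irr G" "finite F" "card F = ?m"
    using infinite_arbitrarily_large[OF \<open>infinite (Irr G)\<close>] by blast
  obtain e where e: "bij_betw e {..<?n} (carrier G)"
    using ex_bij_betw_nat_finite[OF finite_carrier] by (auto simp: atLeast0LessThan)
  obtain c where c: "bij_betw c {..<?m} F"
    using ex_bij_betw_nat_finite[OF F(2)] F(3) by (auto simp: atLeast0LessThan)
  have cI: "c a \<in> Irr G" if "a < ?m" for a using c that F(1) unfolding bij_betw_def by blast
  have cinj: "c a = c b \<longleftrightarrow> a = b" if "a < ?m" "b < ?m" for a b
    using c that unfolding bij_betw_def inj_on_def by blast
  define X where "X = mat ?m ?n (\<lambda>(a, j). c a (e j))"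
  define Y where "Y = mat ?n ?m (\<lambda>(j, b). c b (inv (e j)) / of_nat ?n)"
  have X: "X \<in> carrier_mat ?m ?n" and Y: "Y \<in> carrier_mat ?n ?m" by (simp_all add: X_def Y_def)
  have "X * Y = 1\<^sub>m ?m"
  proof (rule eq_matI)
    fix a b assume "a < dim_row (1\<^sub>m ?m :: complex mat)" "b < dim_col (1\<^sub>m ?m :: complex mat)"
    then have ab: "a < ?m" "b < ?m" by auto
    have "(X * Y) $$ (a, b) = (\<Sum>j<?n. c a (e j) * c b (inv (e j)) / of_nat ?n)"
      unfolding index_mult_mat_sum[OF X Y ab] using ab by (intro sum.cong refl) (simp add: X_def Y_def)
    also have "\<dots> = (\<Sum>g\<in>carrier G. c a g * c b (inv g) / of_nat ?n)"
      by (rule sum.reindex_bij_betw[OF e])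
    also have "\<dots> = (\<Sum>g\<in>carrier G. c a g * c b (inv g)) / of_nat ?n"
      by (simp add: sum_divide_distrib)
    also have "\<dots> = (1\<^sub>m ?m :: complex mat) $$ (a, b)"
      unfolding Irr_orthogonality[OF cI[OF ab(1)] cI[OF ab(2)]] cinj[OF ab] using ab order_pos by simp
    finally show "(X * Y) $$ (a, b) = (1\<^sub>m ?m :: complex mat) $$ (a, b)" .
  qed (use X Y in auto)
  from dim_le_of_one_mat[OF X Y this] show False by simp
qed

end

section \<open>Skew intertwiners for an anti-involution\<close>

locale anti_involution = finite_group +
  fixes \<theta> :: "'a \<Rightarrow> 'a"
  assumes \<theta>_closed: "g \<in> carrier G \<Longrightarrow> \<theta> g \<in> carrier G"
    and \<theta>_\<theta>: "g \<in> carrier G \<Longrightarrow> \<theta> (\<theta> g) = g"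
    and \<theta>_mult: "g \<in> carrier G \<Longrightarrow> h \<in> carrier G \<Longrightarrow> \<theta> (g \<otimes> h) = \<theta> h \<otimes> \<theta> g"
begin

lemma \<theta>_one: "\<theta> \<one> = \<one>"
proof -
  have "\<theta> \<one> \<otimes> \<theta> \<one> = \<theta> \<one>" using \<theta>_mult[of \<one> \<one>] by simp
  then show ?thesis using \<theta>_closed[OF one_closed] by (metis one_closed r_cancel_one)
qed

lemma \<theta>_inv: "g \<in> carrier G \<Longrightarrow> \<theta> (inv g) = inv (\<theta> g)"
  using \<theta>_mult[of g "inv g"] \<theta>_one \<theta>_closed by (metis inv_closed inv_equality r_inv)

lemma bij_\<theta>: "bij_betw \<theta> (carrier G) (carrier G)"
  by (rule bij_betwI[of _ _ _ \<theta>]) (simp_all add: \<theta>_closed \<theta>_\<theta>)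

lemma anti_involution_subgroup:
  assumes K: "subgroup K G" and \<theta>K: "\<And>g. g \<in> K \<Longrightarrow> \<theta> g \<in> K"
  shows "anti_involution (G\<lparr>carrier := K\<rparr>) \<theta>"
proof -
  have KG: "g \<in> carrier G" if "g \<in> K" for g using subgroup.subset[OF K] that by blast
  have "finite K" using finite_subset[OF subgroup.subset[OF K] finite_carrier] .
  then have "finite_group (G\<lparr>carrier := K\<rparr>)"
    using subgroup.subgroup_is_group[OF K group_axioms] by (simp add: finite_group_def finite_group_axioms_def)
  then show ?thesis
    by (rule anti_involution.intro) (unfold_locales, simp_all add: \<theta>K KG \<theta>_\<theta> \<theta>_mult)
qed

definition transpose_rep :: "('a \<Rightarrow> complex mat) \<Rightarrow> 'a \<Rightarrow> complex mat" where
  "transpose_rep \<rho> g = transpose_mat (\<rho> (\<theta> g))"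

lemma matrix_rep_transpose:
  assumes \<rho>: "matrix_rep G d \<rho>"
  shows "matrix_rep G d (transpose_rep \<rho>)"
proof (rule matrix_repI)
  note c = matrix_rep_carrier[OF \<rho> \<theta>_closed]
  show "transpose_rep \<rho> g \<in> carrier_mat d d" if "g \<in> carrier G" for g
    using c[OF that] by (simp add: transpose_rep_def)
  show "transpose_rep \<rho> (g \<otimes> h) = transpose_rep \<rho> g * transpose_rep \<rho> h"
    if g: "g \<in> carrier G" and h: "h \<in> carrier G" for g h
    unfolding transpose_rep_def \<theta>_mult[OF g h] matrix_rep_mult[OF \<rho> \<theta>_closed[OF h] \<theta>_closed[OF g]]
    by (rule transpose_mult[OF c[OF h] c[OF g]])
  show "transpose_rep \<rho> \<one> = 1\<^sub>m d"
    by (simp add: transpose_rep_def \<theta>_one matrix_rep_one[OF \<rho>])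
qed

end

text \<open>
  The condition says that the twisted Frobenius-Schur indicator of no irreducible character is \<open>-1\<close>:
  a skew intertwiner between \<open>g \<mapsto> (\<rho> (\<theta> g))\<^sup>T\<close> and \<open>\<rho>\<close> is the matrix of an alternating bilinear form
  compatible with \<open>\<theta>\<close>.
\<close>

definition no_skew_form :: "('a, 'b) monoid_scheme \<Rightarrow> ('a \<Rightarrow> 'a) \<Rightarrow> bool" where
  "no_skew_form G \<theta> \<longleftrightarrow> (\<forall>d \<rho> A. irreducible_rep G d \<rho> \<longrightarrow> A \<in> carrier_mat d d \<longrightarrow>
    (\<forall>g\<in>carrier G. \<rho> g * A = A * transpose_mat (\<rho> (\<theta> g))) \<longrightarrow> transpose_mat A = - A \<longrightarrow> A = 0\<^sub>m d d)"

text \<open>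
  Every matrix commutes with the trivial group, so by Schur's lemma the matrix unit in the corner is
  a scalar matrix. This forces dimension one, where a skew matrix is zero.
\<close>

lemma no_skew_form_trivial:
  assumes "group G" and triv: "carrier G = {\<one>\<^bsub>G\<^esub>}"
  shows "no_skew_form G \<theta>"
  unfolding no_skew_form_def
proof (intro allI impI)
  fix d \<rho> and A :: "complex mat"
  interpret finite_group G using assms by (simp add: finite_group_def finite_group_axioms_def)
  assume \<rho>: "irreducible_rep G d \<rho>" and A: "A \<in> carrier_mat d d" and skew: "transpose_mat A = - A"
  note \<rho>' = irreducible_repD(1)[OF \<rho>] and d = irreducible_repD(2)[OF \<rho>]
  define B :: "complex mat" where "B = mat d d (\<lambda>(i, j). if i = 0 \<and> j = 0 then 1 else 0)"
  have B: "B \<in> carrier_mat d d" by (simp add: B_def)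
  have "\<rho> g * B = B * \<rho> g" if "g \<in> carrier G" for g
    using that B by (simp add: triv matrix_rep_one[OF \<rho>'])
  from Schur_scalar[OF \<rho> B this] have Bs: "B = (trace B / of_nat d) \<cdot>\<^sub>m 1\<^sub>m d" by simp
  have "d = 1"
  proof (rule ccontr)
    assume "d \<noteq> 1"
    then have "1 < d" using d by simp
    then have "B $$ (0, 0) = 1" "B $$ (1, 1) = 0" by (simp_all add: B_def)
    moreover have "B $$ (0, 0) = B $$ (1, 1)" by (subst (1 2) Bs) (use \<open>1 < d\<close> in simp)
    ultimately show False by simp
  qed
  have "transpose_mat A $$ (0, 0) = (- A) $$ (0, 0)" unfolding skew ..
  then have "A $$ (0, 0) = 0" using A \<open>d = 1\<close> by simp
  then show "A = 0\<^sub>m d d" using A \<open>d = 1\<close> by (intro eq_matI) auto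
qed

context anti_involution
begin

text \<open>
  Let \<open>A\<close> be a nonzero skew intertwiner for \<open>\<rho>\<close>, and \<open>P = Q * C\<close> the equivariant projection onto an
  \<open>H\<close>-irreducible constituent. The coefficients of \<open>P\<close> in the span of the \<open>\<rho> g\<close> are constant on
  \<open>H\<close>-conjugacy classes, hence invariant under \<open>\<theta>\<close>, and so \<open>P * A = A * P\<^sup>T\<close>. The compression
  \<open>C * A * C\<^sup>T\<close> is a skew intertwiner for the constituent. Were it zero, then
  \<open>C * A = C * P * A = C * A * C\<^sup>T * Q\<^sup>T = 0\<close>, contradicting the surjectivity of \<open>A\<close>.
\<close>

lemma no_skew_form_transfer:
  assumes H: "subgroup H G" and \<theta>H: "\<And>h. h \<in> H \<Longrightarrow> \<theta> h \<in> H"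
    and conj: "\<And>g. g \<in> carrier G \<Longrightarrow> \<exists>h\<in>H. h \<otimes> g = \<theta> g \<otimes> h"
    and nsf: "no_skew_form (G\<lparr>carrier := H\<rparr>) \<theta>"
  shows "no_skew_form G \<theta>"
  unfolding no_skew_form_def
proof (intro allI impI, rule ccontr)
  fix d \<rho> A
  assume \<rho>: "irreducible_rep G d \<rho>" and A: "A \<in> carrier_mat d d"
    and tw: "\<forall>g\<in>carrier G. \<rho> g * A = A * transpose_mat (\<rho> (\<theta> g))" and skew: "transpose_mat A = - A"
    and ne: "A \<noteq> 0\<^sub>m d d"
  interpret H: finite_group "G\<lparr>carrier := H\<rparr>"
    using subgroup.subgroup_is_group[OF H group_axioms] finite_subset[OF subgroup.subset[OF H] finite_carrier]
    by (simp add: finite_group_def finite_group_axioms_def)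
  have HG: "h \<in> carrier G" if "h \<in> H" for h using subgroup.subset[OF H] that by blast
  note \<rho>' = irreducible_repD(1)[OF \<rho>] and d = irreducible_repD(2)[OF \<rho>]
  note c = matrix_rep_carrier[OF \<rho>']
  have ct: "transpose_mat (\<rho> (\<theta> g)) \<in> carrier_mat d d" if "g \<in> carrier G" for g
    using c[OF \<theta>_closed[OF that]] by simp
  have \<rho>H: "matrix_rep (G\<lparr>carrier := H\<rparr>) d \<rho>"
    by (rule H.matrix_repI) (use HG c matrix_rep_mult[OF \<rho>'] matrix_rep_one[OF \<rho>'] in auto)
  have inv: "invariant_subspace (G\<lparr>carrier := H\<rparr>) d \<rho> (carrier_vec d)"
    unfolding invariant_subspace_def subspace_vec_iff
    by (auto intro: mult_mat_vec_carrier[OF c[OF HG]])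
  have nz: "carrier_vec d \<noteq> {0\<^sub>v d :: complex vec}"
    using unit_vec_nonzero[where 'a = complex, OF d] unit_vec_carrier[of d 0] by blast
  obtain k \<sigma> Q C
    where \<sigma>: "irreducible_rep (G\<lparr>carrier := H\<rparr>) k \<sigma>" and Q: "Q \<in> carrier_mat d k" and C: "C \<in> carrier_mat k d"
      and CQ: "C * Q = 1\<^sub>m k" and RQ: "\<And>h. h \<in> H \<Longrightarrow> \<rho> h * Q = Q * \<sigma> h"
      and CR: "\<And>h. h \<in> H \<Longrightarrow> C * \<rho> h = \<sigma> h * C"
    using H.irreducible_subrep[OF \<rho>H inv nz] by auto
  have \<sigma>c: "\<sigma> h \<in> carrier_mat k k" if "h \<in> H" for h
    using H.matrix_rep_carrier[OF H.irreducible_repD(1)[OF \<sigma>]] that by simp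
  define P where "P = Q * C"
  have P: "P \<in> carrier_mat d d" unfolding P_def by (rule mult_carrier_mat[OF Q C])
  have Pcomm: "\<rho> h * P = P * \<rho> h" if h: "h \<in> H" for h
  proof -
    have "\<rho> h * P = Q * \<sigma> h * C"
      unfolding P_def RQ[OF h, symmetric] by (rule assoc_mult_mat[OF c[OF HG[OF h]] Q C, symmetric])
    also have "\<dots> = Q * (\<sigma> h * C)" by (rule assoc_mult_mat[OF Q \<sigma>c[OF h] C])
    also have "\<dots> = P * \<rho> h"
      unfolding P_def CR[OF h, symmetric] by (rule assoc_mult_mat[OF Q C c[OF HG[OF h]], symmetric])
    finally show ?thesis .
  qed
  define a where "a g = trace (P * \<rho> (inv g))" for g
  have a_\<theta>: "a (\<theta> g) = a g" if g: "g \<in> carrier G" for g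
  proof -
    obtain h where h: "h \<in> H" and hg: "h \<otimes> g = \<theta> g \<otimes> h" using conj[OF g] by blast
    note hG = HG[OF h] and i = inv_closed[OF g] and ih = inv_closed[OF HG[OF h]]
    have "\<theta> g = h \<otimes> g \<otimes> inv h" using hg hG g \<theta>_closed[OF g] by (simp add: m_assoc)
    then have "inv (\<theta> g) = h \<otimes> (inv g \<otimes> inv h)" using hG g by (simp add: inv_mult_group m_assoc)
    then have "\<rho> (inv (\<theta> g)) = \<rho> h * (\<rho> (inv g) * \<rho> (inv h))"
      using hG g by (simp add: matrix_rep_mult[OF \<rho>'])
    then have "P * \<rho> (inv (\<theta> g)) = P * \<rho> h * (\<rho> (inv g) * \<rho> (inv h))"
      using assoc_mult_mat[OF P c[OF hG] mult_carrier_mat[OF c[OF i] c[OF ih]]] by simp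
    also have "\<dots> = \<rho> h * (P * (\<rho> (inv g) * \<rho> (inv h)))"
      unfolding Pcomm[OF h, symmetric] by (rule assoc_mult_mat[OF c[OF hG] P mult_carrier_mat[OF c[OF i] c[OF ih]]])
    also have "\<dots> = \<rho> h * (P * \<rho> (inv g)) * \<rho> (inv h)"
      unfolding assoc_mult_mat[OF c[OF hG] mult_carrier_mat[OF P c[OF i]] c[OF ih]]
        assoc_mult_mat[OF P c[OF i] c[OF ih]] ..
    finally show ?thesis
      unfolding a_def using trace_conj[OF \<rho>' hG mult_carrier_mat[OF P c[OF i]]] by simp
  qed
  define q :: complex where "q = of_nat d / of_nat (card (carrier G))"
  have PA: "P * A = A * transpose_mat P"
  proof -
    have s1: "a g \<cdot>\<^sub>m \<rho> g \<in> carrier_mat d d" if "g \<in> carrier G" for g using c[OF that] by simp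
    have s2: "a g \<cdot>\<^sub>m \<rho> (\<theta> g) \<in> carrier_mat d d" if "g \<in> carrier G" for g using c[OF \<theta>_closed[OF that]] by simp
    have s3: "a g \<cdot>\<^sub>m transpose_mat (\<rho> (\<theta> g)) \<in> carrier_mat d d" if "g \<in> carrier G" for g using ct[OF that] by simp
    have P1: "P = q \<cdot>\<^sub>m mat_sum d d (\<lambda>g. a g \<cdot>\<^sub>m \<rho> g) (carrier G)"
      unfolding q_def a_def by (rule irreducible_expansion[OF \<rho> P])
    also have "mat_sum d d (\<lambda>g. a g \<cdot>\<^sub>m \<rho> g) (carrier G) = mat_sum d d (\<lambda>g. a (\<theta> g) \<cdot>\<^sub>m \<rho> (\<theta> g)) (carrier G)"
      by (rule mat_sum_reindex[OF bij_\<theta>])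
    also have "\<dots> = mat_sum d d (\<lambda>g. a g \<cdot>\<^sub>m \<rho> (\<theta> g)) (carrier G)"
      by (rule mat_sum_cong[OF refl]) (simp add: a_\<theta>)
    finally have P2: "P = q \<cdot>\<^sub>m mat_sum d d (\<lambda>g. a g \<cdot>\<^sub>m \<rho> (\<theta> g)) (carrier G)" .
    have "transpose_mat P = q \<cdot>\<^sub>m transpose_mat (mat_sum d d (\<lambda>g. a g \<cdot>\<^sub>m \<rho> (\<theta> g)) (carrier G))"
      by (subst P2) (auto intro!: eq_matI)
    also have "\<dots> = q \<cdot>\<^sub>m mat_sum d d (\<lambda>g. a g \<cdot>\<^sub>m transpose_mat (\<rho> (\<theta> g))) (carrier G)"
    proof -
      have "transpose_mat (a g \<cdot>\<^sub>m \<rho> (\<theta> g)) = a g \<cdot>\<^sub>m transpose_mat (\<rho> (\<theta> g))" for g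
        by (auto intro!: eq_matI)
      then show ?thesis by (simp add: transpose_mat_sum[OF s2])
    qed
    finally have Pt: "transpose_mat P = q \<cdot>\<^sub>m mat_sum d d (\<lambda>g. a g \<cdot>\<^sub>m transpose_mat (\<rho> (\<theta> g))) (carrier G)" .
    have "P * A = q \<cdot>\<^sub>m (mat_sum d d (\<lambda>g. a g \<cdot>\<^sub>m \<rho> g) (carrier G) * A)"
      by (subst P1) (rule mult_smult_assoc_mat[OF mat_sum_carrier A])
    also have "mat_sum d d (\<lambda>g. a g \<cdot>\<^sub>m \<rho> g) (carrier G) * A = mat_sum d d (\<lambda>g. a g \<cdot>\<^sub>m \<rho> g * A) (carrier G)"
      by (rule mat_sum_mult[OF A s1])
    also have "\<dots> = mat_sum d d (\<lambda>g. A * (a g \<cdot>\<^sub>m transpose_mat (\<rho> (\<theta> g)))) (carrier G)"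
    proof (rule mat_sum_cong[OF refl])
      fix g assume g: "g \<in> carrier G"
      show "a g \<cdot>\<^sub>m \<rho> g * A = A * (a g \<cdot>\<^sub>m transpose_mat (\<rho> (\<theta> g)))"
        unfolding mult_smult_assoc_mat[OF c[OF g] A] mult_smult_distrib[OF A ct[OF g]] bspec[OF tw g] ..
    qed
    also have "\<dots> = A * mat_sum d d (\<lambda>g. a g \<cdot>\<^sub>m transpose_mat (\<rho> (\<theta> g))) (carrier G)"
      by (rule mult_mat_sum[OF A s3, symmetric])
    also have "q \<cdot>\<^sub>m (A * mat_sum d d (\<lambda>g. a g \<cdot>\<^sub>m transpose_mat (\<rho> (\<theta> g))) (carrier G)) = A * transpose_mat P"
      unfolding Pt by (rule mult_smult_distrib[OF A mat_sum_carrier, symmetric])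
    finally show ?thesis .
  qed
  have Ct: "transpose_mat C \<in> carrier_mat d k" using C by simp
  have CA: "C * A \<in> carrier_mat k d" by (rule mult_carrier_mat[OF C A])
  define A' where "A' = C * A * transpose_mat C"
  have A': "A' \<in> carrier_mat k k" unfolding A'_def by (rule mult_carrier_mat[OF CA Ct])
  have "\<sigma> h * A' = A' * transpose_mat (\<sigma> (\<theta> h))" if h: "h \<in> H" for h
  proof -
    note hG = HG[OF h]
    have "\<sigma> h * A' = \<sigma> h * C * A * transpose_mat C"
      unfolding A'_def using \<sigma>c[OF h] C A by (simp add: assoc_mult_mat_dim)
    also have "\<dots> = C * (\<rho> h * A) * transpose_mat C"
      unfolding CR[OF h, symmetric] using c[OF hG] C A by (simp add: assoc_mult_mat_dim)
    also have "\<dots> = C * A * (transpose_mat (\<rho> (\<theta> h)) * transpose_mat C)"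
      unfolding bspec[OF tw hG] using c[OF \<theta>_closed[OF hG]] C A by (simp add: assoc_mult_mat_dim)
    also have "transpose_mat (\<rho> (\<theta> h)) * transpose_mat C = transpose_mat C * transpose_mat (\<sigma> (\<theta> h))"
      unfolding transpose_mult[OF C c[OF \<theta>_closed[OF hG]], symmetric] CR[OF \<theta>H[OF h]]
      by (rule transpose_mult[OF \<sigma>c[OF \<theta>H[OF h]] C])
    also have "C * A * (transpose_mat C * transpose_mat (\<sigma> (\<theta> h))) = A' * transpose_mat (\<sigma> (\<theta> h))"
      unfolding A'_def using \<sigma>c[OF \<theta>H[OF h]] C A by (simp add: assoc_mult_mat_dim)
    finally show ?thesis .
  qed
  moreover have "transpose_mat A' = - A'"
  proof -
    have "transpose_mat A' = C * (transpose_mat A * transpose_mat C)"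
      unfolding A'_def transpose_mult[OF CA Ct] transpose_mult[OF C A] by simp
    then show ?thesis unfolding skew A'_def using C A Ct by (simp add: assoc_mult_mat_dim)
  qed
  ultimately have "A' = 0\<^sub>m k k"
    using nsf \<sigma> A' unfolding no_skew_form_def by simp
  have "C * A = C * Q * C * A" unfolding CQ left_mult_one_mat[OF C] ..
  also have "\<dots> = C * (P * A)" unfolding P_def using C Q A by (simp add: assoc_mult_mat_dim)
  also have "\<dots> = A' * transpose_mat Q"
    unfolding PA unfolding P_def transpose_mult[OF Q C] A'_def using C Q A by (simp add: assoc_mult_mat_dim)
  also have "\<dots> = 0\<^sub>m k d" unfolding \<open>A' = 0\<^sub>m k k\<close> using Q by simp
  finally have CA0: "C * A = 0\<^sub>m k d" .
  obtain B where B: "B \<in> carrier_mat d d" and AB: "A * B = 1\<^sub>m d"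
    using intertwiner_surj[OF \<rho> matrix_rep_transpose[OF \<rho>'] A _ ne] tw unfolding transpose_rep_def by blast
  have "C = C * A * B" unfolding assoc_mult_mat[OF C A B] AB right_mult_one_mat[OF C] ..
  also have "\<dots> = 0\<^sub>m k d" unfolding CA0 by (rule left_mult_zero_mat[OF B])
  finally have "1\<^sub>m k = (0\<^sub>m k k :: complex mat)" using CQ left_mult_zero_mat[OF Q] by simp
  moreover have "(1\<^sub>m k :: complex mat) $$ (0, 0) \<noteq> 0\<^sub>m k k $$ (0, 0)" using H.irreducible_repD(2)[OF \<sigma>] by simp
  ultimately show False by simp
qed

section \<open>Counting twisted square roots\<close>

text \<open>
  Both sums are sums of entries of averaged matrix units, the left-hand one with the entry indices
  interchanged. Averages are intertwiners, hence symmetric, so the interchange is harmless and the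
  sum equals the inner product of \<open>\<chi>\<close> with the character of the transposed representation, which is
  \<open>\<chi>\<close> itself.
\<close>

lemma sum_twisted_squares:
  assumes nsf: "no_skew_form G \<theta>" and conj: "\<And>g. g \<in> carrier G \<Longrightarrow> \<exists>h\<in>carrier G. h \<otimes> g = \<theta> g \<otimes> h"
    and \<chi>: "\<chi> \<in> Irr G"
  shows "(\<Sum>v\<in>carrier G. \<chi> (v \<otimes> inv (\<theta> v))) = of_nat (card (carrier G))"
proof -
  obtain d \<rho> where \<rho>: "irreducible_rep G d \<rho>" and \<chi>\<rho>: "\<chi> = character G \<rho>" using \<chi> unfolding Irr_def by blast
  note \<rho>' = irreducible_repD(1)[OF \<rho>]
  note \<rho>t = matrix_rep_transpose[OF \<rho>']
  note c = matrix_rep_carrier[OF \<rho>'] and ct = matrix_rep_carrier[OF \<rho>t]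
  define T where "T = twirl d d \<rho> (transpose_rep \<rho>)"
  have Tc: "T X \<in> carrier_mat d d" for X by (simp add: T_def)
  have T_sym: "transpose_mat (T X) = T X" if X: "X \<in> carrier_mat d d" for X
  proof -
    have tw: "\<rho> g * T X = T X * transpose_mat (\<rho> (\<theta> g))" if g: "g \<in> carrier G" for g
      using twirl_intertwines[OF \<rho>' \<rho>t X g] by (simp add: T_def transpose_rep_def)
    have tw': "\<rho> g * transpose_mat (T X) = transpose_mat (T X) * transpose_mat (\<rho> (\<theta> g))" if g: "g \<in> carrier G" for g
    proof -
      have "transpose_mat (\<rho> (\<theta> g) * T X) = transpose_mat (T X * transpose_mat (\<rho> g))"
        unfolding tw[OF \<theta>_closed[OF g]] \<theta>_\<theta>[OF g] ..
      moreover have "transpose_mat (T X * transpose_mat (\<rho> g)) = \<rho> g * transpose_mat (T X)"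
        using transpose_mult[OF Tc, of "transpose_mat (\<rho> g)"] c[OF g] by simp
      ultimately show ?thesis using transpose_mult[OF c[OF \<theta>_closed[OF g]] Tc] by simp
    qed
    define D where "D = transpose_mat (T X) - T X"
    have Tt: "transpose_mat (T X) \<in> carrier_mat d d" using Tc by simp
    have D: "D \<in> carrier_mat d d" unfolding D_def by (rule minus_carrier_mat[OF Tc])
    have "\<rho> g * D = D * transpose_mat (\<rho> (\<theta> g))" if g: "g \<in> carrier G" for g
    proof -
      have t: "transpose_mat (\<rho> (\<theta> g)) \<in> carrier_mat d d" using c[OF \<theta>_closed[OF g]] by simp
      show ?thesis
        unfolding D_def mult_minus_distrib_mat[OF c[OF g] Tt Tc] minus_mult_distrib_mat[OF Tt Tc t] tw[OF g] tw'[OF g] ..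
    qed
    moreover have "transpose_mat D = - D"
      unfolding D_def using Tc[of X] by (intro eq_matI) auto
    ultimately have "D = 0\<^sub>m d d" using nsf \<rho> D unfolding no_skew_form_def by blast
    then show ?thesis unfolding D_def by (rule minus_eq_zero_matD[OF Tt Tc])
  qed
  have "(\<Sum>v\<in>carrier G. \<chi> (v \<otimes> inv (\<theta> v)))
      = (\<Sum>v\<in>carrier G. \<Sum>i<d. \<Sum>j<d. \<rho> v $$ (i, j) * transpose_rep \<rho> (inv v) $$ (i, j))"
  proof (rule sum.cong[OF refl])
    fix v assume v: "v \<in> carrier G"
    note i = inv_closed[OF v] and t = \<theta>_closed[OF inv_closed[OF v]]
    have "\<chi> (v \<otimes> inv (\<theta> v)) = trace (\<rho> v * \<rho> (\<theta> (inv v)))"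
      unfolding \<chi>\<rho> character_def using v t by (simp add: \<theta>_inv[OF v, symmetric] matrix_rep_mult[OF \<rho>' v t])
    also have "\<dots> = (\<Sum>i<d. \<Sum>j<d. \<rho> v $$ (i, j) * \<rho> (\<theta> (inv v)) $$ (j, i))"
      unfolding trace_def index_mult_mat(2) carrier_matD(1)[OF c[OF v]]
      by (intro sum.cong refl index_mult_mat_sum[OF c[OF v] c[OF t]]) auto
    also have "\<dots> = (\<Sum>i<d. \<Sum>j<d. \<rho> v $$ (i, j) * transpose_rep \<rho> (inv v) $$ (i, j))"
      using c[OF t] by (intro sum.cong refl) (simp add: transpose_rep_def)
    finally show "\<chi> (v \<otimes> inv (\<theta> v)) = (\<Sum>i<d. \<Sum>j<d. \<rho> v $$ (i, j) * transpose_rep \<rho> (inv v) $$ (i, j))" .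
  qed
  also have "\<dots> = (\<Sum>i<d. \<Sum>j<d. \<Sum>v\<in>carrier G. \<rho> v $$ (i, j) * transpose_rep \<rho> (inv v) $$ (i, j))"
    by (subst sum.swap, rule sum.cong[OF refl], rule sum.swap)
  also have "\<dots> = (\<Sum>i<d. \<Sum>j<d. T (unit_mat d d j i) $$ (i, j))"
    unfolding T_def by (intro sum.cong refl) (simp add: twirl_unit_mat[OF \<rho>' \<rho>t])
  also have "\<dots> = (\<Sum>i<d. \<Sum>j<d. T (unit_mat d d j i) $$ (j, i))"
  proof (intro sum.cong refl)
    fix i j assume ij: "i \<in> {..<d}" "j \<in> {..<d}"
    have "T (unit_mat d d j i) $$ (i, j) = transpose_mat (T (unit_mat d d j i)) $$ (i, j)"
      by (simp add: T_sym)
    also have "\<dots> = T (unit_mat d d j i) $$ (j, i)" using ij Tc[of "unit_mat d d j i"] by simp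
    finally show "T (unit_mat d d j i) $$ (i, j) = T (unit_mat d d j i) $$ (j, i)" .
  qed
  also have "\<dots> = (\<Sum>i<d. \<Sum>j<d. T (unit_mat d d i j) $$ (i, j))" by (rule sum.swap)
  also have "\<dots> = (\<Sum>g\<in>carrier G. trace (\<rho> g) * trace (transpose_rep \<rho> (inv g)))"
    unfolding T_def by (rule sum_trace_mult_trace_inv[OF \<rho>' \<rho>t, symmetric])
  also have "\<dots> = (\<Sum>g\<in>carrier G. \<chi> g * \<chi> (inv g))"
  proof (rule sum.cong[OF refl])
    fix g assume g: "g \<in> carrier G"
    note i = inv_closed[OF g]
    obtain h where h: "h \<in> carrier G" and hg: "h \<otimes> inv g = \<theta> (inv g) \<otimes> h" using conj[OF i] by blast
    have "\<theta> (inv g) = h \<otimes> inv g \<otimes> inv h" using hg h g \<theta>_closed[OF i] by (simp add: m_assoc)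
    then have "\<rho> (\<theta> (inv g)) = \<rho> h * \<rho> (inv g) * \<rho> (inv h)" using h g by (simp add: matrix_rep_mult[OF \<rho>'])
    then have "trace (transpose_rep \<rho> (inv g)) = trace (\<rho> (inv g))"
      unfolding transpose_rep_def trace_transpose[OF c[OF \<theta>_closed[OF i]]]
      using trace_conj[OF \<rho>' h c[OF i]] by simp
    then show "trace (\<rho> g) * trace (transpose_rep \<rho> (inv g)) = \<chi> g * \<chi> (inv g)"
      using g by (simp add: \<chi>\<rho> character_def)
  qed
  also have "\<dots> = of_nat (card (carrier G))" using Irr_orthogonality[OF \<chi> \<chi>] by simp
  finally show ?thesis .
qed

text \<open>
  Both sides are class functions of \<open>x\<close>, and both have inner product \<open>1\<close> with every irreducible
  character: the left-hand side by orthogonality, the right-hand side because its inner product with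
  \<open>\<chi>\<close> is the twisted indicator of \<open>\<chi>\<close>.
\<close>

theorem sum_Irr_eq_card_twisted_roots:
  assumes nsf: "no_skew_form G \<theta>" and conj: "\<And>g. g \<in> carrier G \<Longrightarrow> \<exists>h\<in>carrier G. h \<otimes> g = \<theta> g \<otimes> h"
    and x: "x \<in> carrier G"
  shows "(\<Sum>\<chi>\<in>Irr G. \<chi> x) = of_nat (card {v \<in> carrier G. v \<otimes> inv (\<theta> v) = x})"
proof -
  define N where "N x = card {v \<in> carrier G. v \<otimes> inv (\<theta> v) = x}" for x
  have N_class: "N (inv h \<otimes> g \<otimes> h) = N g" if g: "g \<in> carrier G" and h: "h \<in> carrier G" for g h
  proof -
    have c1: "inv h \<otimes> (h \<otimes> y) = y" "h \<otimes> (inv h \<otimes> y) = y" if "y \<in> carrier G" for y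
      using h that by (simp_all add: m_assoc[symmetric])
    note t = \<theta>_closed[OF h]
    have c2: "\<theta> h \<otimes> (inv (\<theta> h) \<otimes> y) = y" "inv (\<theta> h) \<otimes> (\<theta> h \<otimes> y) = y" if "y \<in> carrier G" for y
      using t that by (simp_all add: m_assoc[symmetric])
    have key: "(inv h \<otimes> v \<otimes> inv (\<theta> h)) \<otimes> inv (\<theta> (inv h \<otimes> v \<otimes> inv (\<theta> h))) = inv h \<otimes> (v \<otimes> inv (\<theta> v)) \<otimes> h"
      if v: "v \<in> carrier G" for v
    proof -
      have "\<theta> (inv h \<otimes> v \<otimes> inv (\<theta> h)) = inv h \<otimes> (\<theta> v \<otimes> inv (\<theta> h))"
        using h v t by (simp add: \<theta>_mult \<theta>_inv \<theta>_\<theta> \<theta>_closed)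
      then show ?thesis
        using h v t \<theta>_closed[OF v] by (simp add: inv_mult_group m_assoc c2)
    qed
    have "bij_betw (\<lambda>v. inv h \<otimes> v \<otimes> inv (\<theta> h)) {v \<in> carrier G. v \<otimes> inv (\<theta> v) = g}
        {v \<in> carrier G. v \<otimes> inv (\<theta> v) = inv h \<otimes> g \<otimes> h}"
    proof (rule bij_betwI[of _ _ _ "\<lambda>v. h \<otimes> v \<otimes> \<theta> h"])
      show "(\<lambda>v. inv h \<otimes> v \<otimes> inv (\<theta> h)) \<in> {v \<in> carrier G. v \<otimes> inv (\<theta> v) = g}
          \<rightarrow> {v \<in> carrier G. v \<otimes> inv (\<theta> v) = inv h \<otimes> g \<otimes> h}"
        using h t key by auto
      show "(\<lambda>v. h \<otimes> v \<otimes> \<theta> h) \<in> {v \<in> carrier G. v \<otimes> inv (\<theta> v) = inv h \<otimes> g \<otimes> h}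
          \<rightarrow> {v \<in> carrier G. v \<otimes> inv (\<theta> v) = g}"
      proof (rule Pi_I)
        fix v assume "v \<in> {v \<in> carrier G. v \<otimes> inv (\<theta> v) = inv h \<otimes> g \<otimes> h}"
        then have v: "v \<in> carrier G" and e: "v \<otimes> inv (\<theta> v) = inv h \<otimes> g \<otimes> h" by auto
        let ?w = "h \<otimes> v \<otimes> \<theta> h"
        have w: "?w \<in> carrier G" using h v t by simp
        have wv: "inv h \<otimes> ?w \<otimes> inv (\<theta> h) = v" using h v t by (simp add: m_assoc c1)
        have u: "?w \<otimes> inv (\<theta> ?w) \<in> carrier G" using w \<theta>_closed[OF w] by simp
        have "inv h \<otimes> (?w \<otimes> inv (\<theta> ?w)) \<otimes> h = inv h \<otimes> g \<otimes> h" using key[OF w] unfolding wv e by simp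
        then have "?w \<otimes> inv (\<theta> ?w) = g" using inj_onD[OF bij_betw_imp_inj_on[OF bij_conj[OF h]] _ u g] by blast
        then show "?w \<in> {v \<in> carrier G. v \<otimes> inv (\<theta> v) = g}" using w by simp
      qed
    qed (use h t in \<open>auto simp: m_assoc c1 c2\<close>)
    then show ?thesis unfolding N_def by (rule bij_betw_same_card[symmetric])
  qed
  define f where "f g = of_nat (N g) - (\<Sum>\<chi>\<in>Irr G. \<chi> g)" for g
  have "f x = 0"
  proof (rule class_function_eq_zero[OF _ _ x])
    show "f (inv h \<otimes> g \<otimes> h) = f g" if "g \<in> carrier G" "h \<in> carrier G" for g h
    proof -
      have "(\<Sum>\<chi>\<in>Irr G. \<chi> (inv h \<otimes> g \<otimes> h)) = (\<Sum>\<chi>\<in>Irr G. \<chi> g)"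
        by (rule sum.cong[OF refl]) (rule Irr_class_function[OF _ that])
      then show ?thesis unfolding f_def N_class[OF that] by simp
    qed
  next
    fix \<psi> assume \<psi>: "\<psi> \<in> Irr G"
    have "(\<Sum>g\<in>carrier G. of_nat (N g) * \<psi> (inv g))
        = (\<Sum>g\<in>carrier G. \<Sum>v\<in>{v \<in> carrier G. v \<otimes> inv (\<theta> v) = g}. \<psi> (inv (v \<otimes> inv (\<theta> v))))"
      by (intro sum.cong refl) (simp add: N_def)
    also have "\<dots> = (\<Sum>v\<in>carrier G. \<psi> (inv (v \<otimes> inv (\<theta> v))))"
      by (rule sum.group[OF finite_carrier finite_carrier]) (auto simp: \<theta>_closed)
    also have "\<dots> = (\<Sum>v\<in>carrier G. \<psi> (v \<otimes> inv (\<theta> v)))"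
    proof -
      have "(\<Sum>v\<in>carrier G. \<psi> (inv (v \<otimes> inv (\<theta> v)))) = (\<Sum>v\<in>carrier G. \<psi> (\<theta> v \<otimes> inv v))"
        by (intro sum.cong refl) (simp add: inv_mult_group \<theta>_closed)
      also have "\<dots> = (\<Sum>v\<in>carrier G. \<psi> (\<theta> (\<theta> v) \<otimes> inv (\<theta> v)))"
        by (rule sum.reindex_bij_betw[OF bij_\<theta>, symmetric])
      also have "\<dots> = (\<Sum>v\<in>carrier G. \<psi> (v \<otimes> inv (\<theta> v)))"
        by (intro sum.cong refl) (simp add: \<theta>_\<theta>)
      finally show ?thesis .
    qed
    also have "\<dots> = of_nat (card (carrier G))" by (rule sum_twisted_squares[OF nsf conj \<psi>])
    finally have 1: "(\<Sum>g\<in>carrier G. of_nat (N g) * \<psi> (inv g)) = of_nat (card (carrier G))" .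
    have "(\<Sum>g\<in>carrier G. (\<Sum>\<chi>\<in>Irr G. \<chi> g) * \<psi> (inv g)) = (\<Sum>\<chi>\<in>Irr G. \<Sum>g\<in>carrier G. \<chi> g * \<psi> (inv g))"
      unfolding sum_distrib_right by (rule sum.swap)
    also have "\<dots> = (\<Sum>\<chi>\<in>Irr G. if \<chi> = \<psi> then of_nat (card (carrier G)) else 0)"
      by (intro sum.cong refl) (rule Irr_orthogonality[OF _ \<psi>])
    also have "\<dots> = of_nat (card (carrier G))" using finite_Irr \<psi> by simp
    finally show "(\<Sum>g\<in>carrier G. f g * \<psi> (inv g)) = 0"
      unfolding f_def left_diff_distrib sum_subtractf 1 by simp
  qed
  then show ?thesis unfolding f_def N_def by simp
qed

end

section \<open>Reversing a permutation by a smaller one\<close>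

text \<open>
  For the monomial matrix \<open>g\<close> with permutation \<open>\<sigma>\<close> and exponents \<open>z\<close>, the pair \<open>(\<pi>, y)\<close> is a
  monomial matrix that conjugates \<open>g\<close> to its transpose, and \<open>\<pi>\<close> fixes the prescribed letter \<open>a\<close>. The
  exponent equation is solved exactly, before any reduction modulo \<open>r\<close>.

  If \<open>\<sigma>\<close> fixes \<open>a\<close>, another letter may be removed instead. Otherwise \<open>\<sigma> = s \<circ> \<sigma>'\<close>, where \<open>s\<close>
  exchanges \<open>a\<close> with \<open>b = \<sigma> a\<close> and \<open>\<sigma>'\<close> fixes \<open>a\<close>. Let \<open>h\<close> conjugate \<open>g' = (\<sigma>', z)\<close> to its transpose with
  \<open>b\<close> fixed as well. Once its exponents at \<open>a\<close> and \<open>b\<close> agree, \<open>h\<close> commutes with \<open>s\<close>, and then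
  \<open>h * g'\<close> conjugates \<open>s * g'\<close> to its transpose.
\<close>

lemma reversing_permutation:
  fixes z :: "'a \<Rightarrow> 'b :: ab_group_add"
  assumes "finite A" "\<sigma> permutes A" "a \<in> A"
  shows "\<exists>\<pi> y. \<pi> permutes A - {a} \<and> (\<forall>j. \<sigma> (\<pi> (\<sigma> j)) = \<pi> j)
    \<and> (\<forall>j. y (\<sigma> j) + z j = z (\<pi> (\<sigma> j)) + y j)"
  using assms
proof (induction A arbitrary: a \<sigma> rule: finite_psubset_induct)
  case (psubset A)
  show ?case
  proof (cases "\<sigma> a = a")
    case True
    then have \<sigma>: "\<sigma> permutes A - {a}"
      using psubset.prems by (intro permutes_superset[OF psubset.prems(1)]) auto
    show ?thesis
    proof (cases "A - {a} = {}")
      case True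
      then have "\<sigma> permutes {}" using \<sigma> unfolding True by blast
      then have "\<sigma> x = x" for x by simp
      then show ?thesis unfolding True by (intro exI[of _ id] exI[of _ "\<lambda>_. 0"]) (simp add: fun_eq_iff)
    next
      case False
      then obtain b where b: "b \<in> A - {a}" by blast
      have "A - {a} \<subset> A" using psubset.prems by blast
      from psubset.IH[OF this \<sigma> b] obtain \<pi> y where \<pi>: "\<pi> permutes A - {a} - {b}"
        and *: "\<forall>j. \<sigma> (\<pi> (\<sigma> j)) = \<pi> j" "\<forall>j. y (\<sigma> j) + z j = z (\<pi> (\<sigma> j)) + y j" by blast
      have "\<pi> permutes A - {a}" by (rule permutes_subset[OF \<pi>]) blast
      with * show ?thesis by blast
    qed
  next
    case False
    define b where "b = \<sigma> a"
    have b: "b \<in> A - {a}" using False psubset.prems permutes_in_image[OF psubset.prems(1)] by (simp add: b_def)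
    define s where "s = transpose a b"
    have s: "s permutes A" unfolding s_def using b psubset.prems by (intro permutes_swap_id) auto
    have ss: "s (s x) = x" for x by (simp add: s_def)
    define \<sigma>' where "\<sigma>' = s \<circ> \<sigma>"
    have \<sigma>_eq: "\<sigma> x = s (\<sigma>' x)" for x by (simp add: \<sigma>'_def ss)
    have \<sigma>'A: "\<sigma>' permutes A" unfolding \<sigma>'_def by (rule permutes_compose[OF psubset.prems(1) s])
    have \<sigma>'a: "\<sigma>' a = a" by (simp add: \<sigma>'_def s_def b_def)
    have \<sigma>': "\<sigma>' permutes A - {a}" by (rule permutes_superset[OF \<sigma>'A]) (use \<sigma>'a in auto)
    have "A - {a} \<subset> A" using psubset.prems by blast
    from psubset.IH[OF this \<sigma>' b] obtain \<pi> y where \<pi>: "\<pi> permutes A - {a} - {b}"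
      and \<pi>\<sigma>: "\<And>j. \<sigma>' (\<pi> (\<sigma>' j)) = \<pi> j" and y: "\<And>j. y (\<sigma>' j) + z j = z (\<pi> (\<sigma>' j)) + y j" by blast
    have fixed: "\<pi> a = a" "\<pi> b = b" using permutes_not_in[OF \<pi>] by auto
    have inj: "\<pi> x = \<pi> x' \<longleftrightarrow> x = x'" for x x' using permutes_inj[OF \<pi>] by (simp add: inj_eq)
    have \<pi>s: "s (\<pi> (s x)) = \<pi> x" for x
      using inj[of x a] inj[of x b] fixed by (auto simp: s_def transpose_def)
    \<comment> \<open>Changing the exponent at \<open>a\<close> is harmless because \<open>\<sigma>'\<close> and \<open>\<pi>\<close> fix \<open>a\<close>.\<close>
    define y' where "y' = y(a := y b)"
    have y's: "y' (s x) = y' x" for x using b by (auto simp: y'_def s_def transpose_def)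
    have \<sigma>'x: "\<sigma>' x = a \<longleftrightarrow> x = a" for x using permutes_inj[OF \<sigma>'] \<sigma>'a by (metis inj_eq)
    have y': "y' (\<sigma>' j) + z j = z (\<pi> (\<sigma>' j)) + y' j" for j
      using y[of j] \<sigma>'x[of j] fixed \<sigma>'a by (cases "j = a") (auto simp: y'_def add.commute)
    show ?thesis
    proof (intro exI conjI allI)
      show "\<pi> \<circ> \<sigma>' permutes A - {a}"
        by (rule permutes_compose[OF \<sigma>' permutes_subset[OF \<pi>]]) blast
      show "\<sigma> ((\<pi> \<circ> \<sigma>') (\<sigma> j)) = (\<pi> \<circ> \<sigma>') j" for j
        unfolding \<sigma>_eq o_def \<pi>\<sigma> by (rule \<pi>s)
      show "(y' (\<sigma>' (\<sigma> j)) + z (\<sigma> j)) + z j = z ((\<pi> \<circ> \<sigma>') (\<sigma> j)) + (y' (\<sigma>' j) + z j)" for j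
        using y'[of "\<sigma> j"] y's[of "\<sigma>' j"] by (simp add: \<sigma>_eq[of j] add.assoc)
    qed
  qed
qed

section \<open>The wreath product and transposition of monomial matrices\<close>

context
  fixes r n :: nat
  assumes r: "r \<ge> 1"
begin

abbreviation (input) "W \<equiv> wreath_group r n"

lemma wreath_carrier:
  "(\<sigma>, c) \<in> carrier W \<longleftrightarrow> \<sigma> permutes {1..n} \<and> c \<in> {1..n} \<rightarrow>\<^sub>E {0..<int r}"
  using r by (simp add: wreath_group_def sym_group_def carrier_integer_mod_group)

lemma wreath_mult:
  "(\<sigma>, c) \<otimes>\<^bsub>W\<^esub> (\<tau>, d) = (\<sigma> \<circ> \<tau>, \<lambda>j\<in>{1..n}. (c (\<tau> j) + d j) mod int r)"
  by (simp add: wreath_group_def sym_group_def)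

lemma wreath_one: "\<one>\<^bsub>W\<^esub> = (id, \<lambda>j\<in>{1..n}. 0)"
  by (simp add: wreath_group_def sym_group_def)

lemma bar_eq:
  assumes "c \<in> {1..n} \<rightarrow>\<^sub>E {0..<int r}"
  shows "bar r n (\<sigma>, c) = (\<sigma>, \<lambda>j\<in>{1..n}. (- c j) mod int r)"
proof -
  have "c j \<in> carrier (integer_mod_group r)" if "j \<in> {1..n}" for j
    using PiE_mem[OF assms that] r by (simp add: carrier_integer_mod_group)
  then show ?thesis unfolding bar_def prod.case by (auto intro!: restrict_ext)
qed

lemma colour_vector: "(\<lambda>j\<in>{1..n}. f j mod int r) \<in> {1..n} \<rightarrow>\<^sub>E {0..<int r}"
  using r by auto

lemma colour_vector_mod:
  "c \<in> {1..n} \<rightarrow>\<^sub>E {0..<int r} \<Longrightarrow> (\<lambda>j\<in>{1..n}. c j mod int r) = c"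
  by (rule extensionalityI[of _ "{1..n}"]) (auto simp: PiE_iff)

lemma finite_group_wreath: "finite_group W"
proof -
  have "carrier W \<subseteq> {\<sigma>. \<sigma> permutes {1..n}} \<times> ({1..n} \<rightarrow>\<^sub>E {0..<int r})"
    using wreath_carrier by auto
  moreover have "finite ({\<sigma>. \<sigma> permutes {1..n}} \<times> ({1..n} \<rightarrow>\<^sub>E {0..<int r}))"
    by (intro finite_cartesian_product finite_permutations finite_PiE) auto
  ultimately have "finite (carrier W)" by (rule finite_subset)
  then show ?thesis using wreath_group_is_group by (simp add: finite_group_def finite_group_axioms_def)
qed

lemma bar_closed:
  assumes v: "v \<in> carrier W"
  shows "bar r n v \<in> carrier W"
proof -
  obtain \<sigma> c where vc: "v = (\<sigma>, c)" by (cases v)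
  have c: "\<sigma> permutes {1..n}" "c \<in> {1..n} \<rightarrow>\<^sub>E {0..<int r}" using v unfolding vc wreath_carrier by blast+
  show ?thesis unfolding vc bar_eq[OF c(2)] wreath_carrier by (intro conjI c(1) colour_vector)
qed

lemma bar_bar:
  assumes v: "v \<in> carrier W"
  shows "bar r n (bar r n v) = v"
proof -
  obtain \<sigma> c where vc: "v = (\<sigma>, c)" by (cases v)
  have c: "c \<in> {1..n} \<rightarrow>\<^sub>E {0..<int r}" using v unfolding vc wreath_carrier by blast
  have "(\<lambda>j\<in>{1..n}. (- (\<lambda>j\<in>{1..n}. (- c j) mod int r) j) mod int r) = (\<lambda>j\<in>{1..n}. c j mod int r)"
    by (rule restrict_ext) (simp add: mod_minus_eq)
  then show ?thesis
    unfolding vc bar_eq[OF c] bar_eq[OF colour_vector] colour_vector_mod[OF c] by simp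
qed

lemma bar_mult:
  assumes v: "v \<in> carrier W" and w: "w \<in> carrier W"
  shows "bar r n (v \<otimes>\<^bsub>W\<^esub> w) = bar r n v \<otimes>\<^bsub>W\<^esub> bar r n w"
proof -
  obtain \<sigma> c \<tau> d where vc: "v = (\<sigma>, c)" and wd: "w = (\<tau>, d)" by (cases v, cases w)
  have c: "c \<in> {1..n} \<rightarrow>\<^sub>E {0..<int r}" and d: "d \<in> {1..n} \<rightarrow>\<^sub>E {0..<int r}" and \<tau>: "\<tau> permutes {1..n}"
    using v w unfolding vc wd wreath_carrier by blast+
  have "(\<lambda>j\<in>{1..n}. (- (\<lambda>j\<in>{1..n}. (c (\<tau> j) + d j) mod int r) j) mod int r)
      = (\<lambda>j\<in>{1..n}. ((\<lambda>j\<in>{1..n}. (- c j) mod int r) (\<tau> j) + (\<lambda>j\<in>{1..n}. (- d j) mod int r) j) mod int r)"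
  proof (rule restrict_ext)
    fix j assume j: "j \<in> {1..n}"
    then have "\<tau> j \<in> {1..n}" using permutes_in_image[OF \<tau>] by blast
    with j show "(- (\<lambda>j\<in>{1..n}. (c (\<tau> j) + d j) mod int r) j) mod int r
        = ((\<lambda>j\<in>{1..n}. (- c j) mod int r) (\<tau> j) + (\<lambda>j\<in>{1..n}. (- d j) mod int r) j) mod int r"
      by (simp only: restrict_apply' mod_simps) simp
  qed
  then show ?thesis
    unfolding vc wd bar_eq[OF c] bar_eq[OF d] wreath_mult bar_eq[OF colour_vector] by simp
qed

definition transposed :: "(nat \<Rightarrow> nat) \<times> (nat \<Rightarrow> int) \<Rightarrow> (nat \<Rightarrow> nat) \<times> (nat \<Rightarrow> int)" where
  "transposed v = inv\<^bsub>W\<^esub> (bar r n v)"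

lemma bar_inv:
  assumes v: "v \<in> carrier W"
  shows "bar r n (inv\<^bsub>W\<^esub> v) = inv\<^bsub>W\<^esub> (bar r n v)"
proof -
  interpret finite_group W by (rule finite_group_wreath)
  interpret group_hom W W "bar r n"
    by unfold_locales (auto simp: hom_def bar_closed bar_mult)
  show ?thesis by (rule hom_inv[OF v])
qed

lemma anti_involution_wreath: "anti_involution W transposed"
proof -
  interpret finite_group W by (rule finite_group_wreath)
  show ?thesis
    by unfold_locales
      (simp_all add: transposed_def bar_closed bar_inv bar_bar bar_mult inv_mult_group)
qed

lemma inv_transposed: "v \<in> carrier W \<Longrightarrow> inv\<^bsub>W\<^esub> (transposed v) = bar r n v"
  using group.inv_inv[OF wreath_group_is_group bar_closed] by (simp add: transposed_def)

text \<open>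
  This form of the conjugacy involves no inverses, so it can be checked on colours directly.
\<close>

lemma transposed_conj_iff:
  assumes v: "v \<in> carrier W" and h: "h \<in> carrier W"
  shows "h \<otimes>\<^bsub>W\<^esub> v = transposed v \<otimes>\<^bsub>W\<^esub> h \<longleftrightarrow> bar r n v \<otimes>\<^bsub>W\<^esub> (h \<otimes>\<^bsub>W\<^esub> v) = h"
proof -
  interpret finite_group W by (rule finite_group_wreath)
  note b = bar_closed[OF v] and hv = m_closed[OF h v]
  show ?thesis
    unfolding transposed_def
  proof
    assume "h \<otimes>\<^bsub>W\<^esub> v = inv\<^bsub>W\<^esub> (bar r n v) \<otimes>\<^bsub>W\<^esub> h"
    then show "bar r n v \<otimes>\<^bsub>W\<^esub> (h \<otimes>\<^bsub>W\<^esub> v) = h" using h b by (simp add: m_assoc[symmetric])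
  next
    assume *: "bar r n v \<otimes>\<^bsub>W\<^esub> (h \<otimes>\<^bsub>W\<^esub> v) = h"
    have "inv\<^bsub>W\<^esub> (bar r n v) \<otimes>\<^bsub>W\<^esub> (bar r n v \<otimes>\<^bsub>W\<^esub> (h \<otimes>\<^bsub>W\<^esub> v)) = h \<otimes>\<^bsub>W\<^esub> v"
      using b hv by (simp add: m_assoc[OF inv_closed[OF b] b hv, symmetric])
    then show "h \<otimes>\<^bsub>W\<^esub> v = inv\<^bsub>W\<^esub> (bar r n v) \<otimes>\<^bsub>W\<^esub> h" unfolding * ..
  qed
qed

text \<open>
  The chain of subgroups. All of them contain every colour vector, so for \<open>m \<le> n\<close> the group with index \<open>m\<close> is
  \<open>G(r,m)\<close> times \<open>n - m\<close> copies of \<open>\<int>\<close> modulo \<open>r\<close>.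
\<close>

definition moving :: "nat \<Rightarrow> ((nat \<Rightarrow> nat) \<times> (nat \<Rightarrow> int)) set" where
  "moving m = {v \<in> carrier W. fst v permutes {1..m}}"

lemma moving_all: "moving n = carrier W"
  using wreath_carrier by (auto simp: moving_def)

lemma subgroup_moving: "subgroup (moving m) W"
proof -
  interpret finite_group W by (rule finite_group_wreath)
  show ?thesis
  proof (rule subgroupI)
    show "moving m \<subseteq> carrier W" by (auto simp: moving_def)
    have "\<one>\<^bsub>W\<^esub> \<in> moving m" using one_closed by (simp add: moving_def wreath_one permutes_id)
    then show "moving m \<noteq> {}" by blast
  next
    fix v assume v: "v \<in> moving m"
    then have vW: "v \<in> carrier W" and p: "fst v permutes {1..m}" by (auto simp: moving_def)
    have "fst (v \<otimes>\<^bsub>W\<^esub> inv\<^bsub>W\<^esub> v) = fst v \<circ> fst (inv\<^bsub>W\<^esub> v)"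
      by (cases v, cases "inv\<^bsub>W\<^esub> v") (simp add: wreath_mult)
    then have "fst v \<circ> fst (inv\<^bsub>W\<^esub> v) = id" using vW by (simp add: wreath_one)
    then have "fst (inv\<^bsub>W\<^esub> v) = Hilbert_Choice.inv (fst v)"
      using permutes_inv_o(2)[OF p] by (metis comp_assoc comp_id id_comp)
    then show "inv\<^bsub>W\<^esub> v \<in> moving m" using vW permutes_inv[OF p] by (simp add: moving_def)
  next
    fix v w assume v: "v \<in> moving m" and w: "w \<in> moving m"
    have "fst (v \<otimes>\<^bsub>W\<^esub> w) = fst v \<circ> fst w" by (cases v, cases w) (simp add: wreath_mult)
    then show "v \<otimes>\<^bsub>W\<^esub> w \<in> moving m"
      using v w permutes_compose[of "fst w" _ "fst v"] by (auto simp: moving_def)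
  qed
qed

lemma transposed_moving:
  assumes v: "v \<in> moving m"
  shows "transposed v \<in> moving m"
proof -
  have "fst (bar r n v) = fst v" by (cases v) (simp add: bar_def)
  then have "bar r n v \<in> moving m" using v bar_closed by (simp add: moving_def)
  then show ?thesis unfolding transposed_def by (rule subgroup.m_inv_closed[OF subgroup_moving])
qed

lemma moving_conj_transposed:
  assumes m: "Suc m \<le> n" and v: "v \<in> moving (Suc m)"
  shows "\<exists>h\<in>moving m. h \<otimes>\<^bsub>W\<^esub> v = transposed v \<otimes>\<^bsub>W\<^esub> h"
proof -
  obtain \<sigma> c where vc: "v = (\<sigma>, c)" by (cases v)
  have vW: "v \<in> carrier W" and \<sigma>: "\<sigma> permutes {1..Suc m}" using v by (auto simp: moving_def vc)
  then have \<sigma>n: "\<sigma> permutes {1..n}" and c: "c \<in> {1..n} \<rightarrow>\<^sub>E {0..<int r}" unfolding vc wreath_carrier by blast+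
  obtain \<pi> y where \<pi>': "\<pi> permutes {1..Suc m} - {Suc m}" and \<sigma>\<pi>: "\<And>j. \<sigma> (\<pi> (\<sigma> j)) = \<pi> j"
    and y: "\<And>j. y (\<sigma> j) + c j = c (\<pi> (\<sigma> j)) + y j"
    using reversing_permutation[OF _ \<sigma>, of "Suc m" c] by auto
  have "{1..Suc m} - {Suc m} = {1..m}" by auto
  then have \<pi>: "\<pi> permutes {1..m}" using \<pi>' by simp
  have \<pi>n: "\<pi> permutes {1..n}" by (rule permutes_subset[OF \<pi>]) (use m in auto)
  define h where "h = (\<pi>, \<lambda>j\<in>{1..n}. y j mod int r)"
  have hW: "h \<in> carrier W" unfolding h_def wreath_carrier by (intro conjI \<pi>n colour_vector)
  then have hm: "h \<in> moving m" using \<pi> by (simp add: moving_def h_def)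
  have "bar r n v \<otimes>\<^bsub>W\<^esub> (h \<otimes>\<^bsub>W\<^esub> v) = h"
  proof -
    have "\<sigma> \<circ> (\<pi> \<circ> \<sigma>) = \<pi>" using \<sigma>\<pi> by (auto simp: o_def)
    moreover have "(\<lambda>j\<in>{1..n}. ((\<lambda>j\<in>{1..n}. (- c j) mod int r) ((\<pi> \<circ> \<sigma>) j)
        + (\<lambda>j\<in>{1..n}. ((\<lambda>j\<in>{1..n}. y j mod int r) (\<sigma> j) + c j) mod int r) j) mod int r)
      = (\<lambda>j\<in>{1..n}. y j mod int r)"
    proof (rule restrict_ext)
      fix j assume j: "j \<in> {1..n}"
      have 1: "\<sigma> j \<in> {1..n}" using j permutes_in_image[OF \<sigma>n] by blast
      then have 2: "\<pi> (\<sigma> j) \<in> {1..n}" using permutes_in_image[OF \<pi>n] by simp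
      have "((\<lambda>j\<in>{1..n}. (- c j) mod int r) ((\<pi> \<circ> \<sigma>) j)
          + (\<lambda>j\<in>{1..n}. ((\<lambda>j\<in>{1..n}. y j mod int r) (\<sigma> j) + c j) mod int r) j) mod int r
        = (- c (\<pi> (\<sigma> j)) + (y (\<sigma> j) + c j)) mod int r"
        unfolding o_apply restrict_apply'[OF j] restrict_apply'[OF 1] restrict_apply'[OF 2] mod_simps ..
      also have "- c (\<pi> (\<sigma> j)) + (y (\<sigma> j) + c j) = y j" unfolding y by simp
      finally show "((\<lambda>j\<in>{1..n}. (- c j) mod int r) ((\<pi> \<circ> \<sigma>) j)
          + (\<lambda>j\<in>{1..n}. ((\<lambda>j\<in>{1..n}. y j mod int r) (\<sigma> j) + c j) mod int r) j) mod int r = y j mod int r" .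
    qed
    ultimately show ?thesis unfolding vc h_def bar_eq[OF c] wreath_mult by simp
  qed
  then show ?thesis using transposed_conj_iff[OF vW hW] hm by blast
qed

text \<open>
  The chain is climbed from the trivial group. The first step goes to the group of diagonal matrices,
  all of which equal their own transpose.
\<close>

lemma no_skew_form_moving:
  "m \<le> n \<Longrightarrow> no_skew_form (W\<lparr>carrier := moving m\<rparr>) transposed"
proof (induction m)
  case 0
  interpret W: anti_involution W transposed by (rule anti_involution_wreath)
  interpret K: anti_involution "W\<lparr>carrier := moving 0\<rparr>" transposed
    by (rule W.anti_involution_subgroup[OF subgroup_moving transposed_moving])
  have fixed: "transposed v = v" if v: "v \<in> moving 0" for v
  proof -
    obtain \<sigma> c where vc: "v = (\<sigma>, c)" by (cases v)
    have vW: "v \<in> carrier W" and "\<sigma> = id" using v by (auto simp: moving_def vc)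
    have c: "c \<in> {1..n} \<rightarrow>\<^sub>E {0..<int r}" using vW unfolding vc wreath_carrier by blast
    have "(\<lambda>j\<in>{1..n}. ((\<lambda>j\<in>{1..n}. (- c j) mod int r) j + c j) mod int r) = (\<lambda>j\<in>{1..n}. 0)"
      by (rule restrict_ext) (simp add: mod_simps)
    then have "bar r n v \<otimes>\<^bsub>W\<^esub> v = \<one>\<^bsub>W\<^esub>"
      unfolding vc bar_eq[OF c] wreath_mult wreath_one \<open>\<sigma> = id\<close> by simp
    then show ?thesis
      unfolding transposed_def using W.inv_equality[OF _ vW bar_closed[OF vW]] W.inv_inv[OF vW] W.inv_equality vW bar_closed[OF vW]
      by (metis W.inv_inv)
  qed
  show ?case
  proof (rule K.no_skew_form_transfer[OF K.triv_subgroup])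
    show "transposed h \<in> {\<one>\<^bsub>W\<lparr>carrier := moving 0\<rparr>\<^esub>}" if "h \<in> {\<one>\<^bsub>W\<lparr>carrier := moving 0\<rparr>\<^esub>}" for h
      using that K.\<theta>_one by simp
    show "\<exists>h\<in>{\<one>\<^bsub>W\<lparr>carrier := moving 0\<rparr>\<^esub>}. h \<otimes>\<^bsub>W\<lparr>carrier := moving 0\<rparr>\<^esub> g = transposed g \<otimes>\<^bsub>W\<lparr>carrier := moving 0\<rparr>\<^esub> h"
      if "g \<in> carrier (W\<lparr>carrier := moving 0\<rparr>)" for g
      using that fixed K.l_one[OF that] K.r_one[OF that] by simp
    show "no_skew_form (W\<lparr>carrier := moving 0, carrier := {\<one>\<^bsub>W\<lparr>carrier := moving 0\<rparr>\<^esub>}\<rparr>) transposed"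
      by (rule no_skew_form_trivial) (use K.subgroup_imp_group[OF K.triv_subgroup] in simp_all)
  qed
next
  case (Suc m)
  interpret W: anti_involution W transposed by (rule anti_involution_wreath)
  interpret K: anti_involution "W\<lparr>carrier := moving (Suc m)\<rparr>" transposed
    by (rule W.anti_involution_subgroup[OF subgroup_moving transposed_moving])
  have sub: "moving m \<subseteq> moving (Suc m)"
    unfolding moving_def by (auto intro: permutes_subset)
  show ?case
  proof (rule K.no_skew_form_transfer[OF W.subgroup_incl[OF subgroup_moving subgroup_moving sub] transposed_moving])
    show "\<exists>h\<in>moving m. h \<otimes>\<^bsub>W\<lparr>carrier := moving (Suc m)\<rparr>\<^esub> g = transposed g \<otimes>\<^bsub>W\<lparr>carrier := moving (Suc m)\<rparr>\<^esub> h"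
      if "g \<in> carrier (W\<lparr>carrier := moving (Suc m)\<rparr>)" for g
      using moving_conj_transposed[OF Suc.prems] that by simp
  qed (use Suc in simp_all)
qed

lemma sum_Irr_wreath:
  assumes n: "n \<ge> 1" and g: "g \<in> carrier W"
  shows "(\<Sum>\<chi>\<in>Irr W. \<chi> g) = of_nat (card {v \<in> carrier W. v \<otimes>\<^bsub>W\<^esub> bar r n v = g})"
proof -
  interpret W: anti_involution W transposed by (rule anti_involution_wreath)
  have nsf: "no_skew_form W transposed"
    using no_skew_form_moving[of n] by (simp add: moving_all)
  have conj: "\<exists>h\<in>carrier W. h \<otimes>\<^bsub>W\<^esub> v = transposed v \<otimes>\<^bsub>W\<^esub> h" if v: "v \<in> carrier W" for v
    using moving_conj_transposed[of "n - 1" v] n v by (auto simp: moving_all) (auto simp: moving_def)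
  have "{v \<in> carrier W. v \<otimes>\<^bsub>W\<^esub> bar r n v = g} = {v \<in> carrier W. v \<otimes>\<^bsub>W\<^esub> inv\<^bsub>W\<^esub> (transposed v) = g}"
    using inv_transposed by auto
  then show ?thesis using W.sum_Irr_eq_card_twisted_roots[OF nsf conj g] by simp
qed

end

theorem theorem3p4:
  fixes r n :: nat and g :: "(nat \<Rightarrow> nat) \<times> (nat \<Rightarrow> int)"
  assumes "r \<ge> 1" and "n \<ge> 1"
    and "g \<in> carrier (wreath_group r n)"
  shows "(\<Sum>\<chi>\<in>Irr (wreath_group r n). \<chi> g) =
    of_nat (card {v \<in> carrier (wreath_group r n). v \<otimes>\<^bsub>wreath_group r n\<^esub> bar r n v = g})"
  using sum_Irr_wreath[OF assms] .

end
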